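(* There exists an absolute constant $C>0$ such that for infinitely many positive integers $n$, one has, for all positive integers $k$, $$\omega(n+k)\le \Omega(n+k)\le Ck.$$ In particular, for such $n$ one has $\tau(n+k)\le 2^{Ck}$ for all positive integers $k$.
   Context: $\omega(m)$ denotes the number of distinct prime divisors of $m$; $\Omega(m)=\sum_p \nu_p(m)$ denotes the number of prime divisors of $m$ counted with multiplicity, where $\nu_p(m)$ is the exponent of the prime $p$ in $m$; $\tau(m)$ denotes the number of positive divisors of $m$. *)

theory Defs
  imports Complex_Main "HOL-Computational_Algebra.Primes"
begin

definition omega :: "nat \<Rightarrow> nat" where
  "omega m = card (prime_factors m)"

definition Omega :: "nat \<Rightarrow> nat" where
  "Omega m = (\<Sum>p\<in>prime_factors m. multiplicity p m)"

definition tau :: "nat \<Rightarrow> nat" where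
  "tau m = card {d. d dvd m}"

end

theory Submission
  imports Defs "HOL-Number_Theory.Number_Theory" "HOL-Library.Disjoint_Sets"
begin

text \<open>
  Sieve out those \<open>n\<close> for which some \<open>n + k\<close> has a prime factor between a small base \<open>y\<close> and
  \<open>z k\<close>, where \<open>log (z k)\<close> is about \<open>2 ^ (- k) * log n\<close>. The sieve dimension grows like \<open>j\<close> on the \<open>j\<close>-th
  range of primes, but the primes there are at most \<open>n ^ (c * 2 ^ (- j))\<close>, so that the Brun-Hooley
  sieve gives a lower bound of the right order for the number of survivors, and the same upper bound up to \<open>O(1) ^ k / D\<close> for
  the survivors with \<open>D dvd n + k\<close>, for suitable \<open>D\<close> with at most \<open>k\<close> prime factors. A prime factor
  of \<open>n + k\<close> above \<open>n ^ (c / k)\<close> can occur only \<open>O(k)\<close> times. The reciprocals of the primes between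
  \<open>z k\<close> and \<open>n ^ (c / k)\<close> sum to \<open>O(k)\<close> by Chebyshev's bound, so a factorial moment of order \<open>k\<close> shows
  that the proportion of survivors for which \<open>n + k\<close> has more than \<open>C * k\<close> such prime factors is at most
  \<open>(1 / 100) ^ k\<close> up to a constant; repeated prime factors are controlled by square divisors \<open>d\<^sup>2\<close> with
  \<open>d > y ^ k\<close>. Summing over \<open>k\<close>, some survivor remains. Only upper bounds on sums over primes are needed.
\<close>

section \<open>Elementary symmetric sums and Bonferroni inequalities\<close>

definition esym :: "nat \<Rightarrow> ('a \<Rightarrow> real) \<Rightarrow> 'a set \<Rightarrow> real" where
  "esym n f A = (\<Sum>Y | Y \<subseteq> A \<and> card Y = n. \<Prod>p\<in>Y. f p)"

text \<open>With negated arguments this is the expansion of the product of \<open>1 - f p\<close>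
  cut off at order \<open>n\<close>, that is, truncated inclusion-exclusion.\<close>

definition esym_upto :: "nat \<Rightarrow> ('a \<Rightarrow> real) \<Rightarrow> 'a set \<Rightarrow> real" where
  "esym_upto n f A = (\<Sum>Y | Y \<subseteq> A \<and> card Y \<le> n. \<Prod>p\<in>Y. f p)"

lemma sum_subsets_insert:
  fixes f :: "'a \<Rightarrow> real"
  assumes "finite A" "p \<notin> A"
  shows "(\<Sum>Y | Y \<subseteq> insert p A \<and> Q Y. \<Prod>p\<in>Y. f p) =
    (\<Sum>Y | Y \<subseteq> A \<and> Q Y. \<Prod>p\<in>Y. f p) + f p * (\<Sum>Y | Y \<subseteq> A \<and> Q (insert p Y). \<Prod>p\<in>Y. f p)"
proof -
  let ?B = "{Y. Y \<subseteq> A \<and> Q (insert p Y)}"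
  have split: "{Y. Y \<subseteq> insert p A \<and> Q Y} = {Y. Y \<subseteq> A \<and> Q Y} \<union> insert p ` ?B"
  proof (intro equalityI subsetI)
    fix Y assume Y: "Y \<in> {Y. Y \<subseteq> insert p A \<and> Q Y}"
    show "Y \<in> {Y. Y \<subseteq> A \<and> Q Y} \<union> insert p ` ?B"
    proof (cases "p \<in> Y")
      case True
      then have "Y = insert p (Y - {p})" by blast
      moreover have "Y - {p} \<in> ?B" using Y True by (auto simp: insert_absorb)
      ultimately show ?thesis by blast
    qed (use Y in auto)
  qed auto
  have inj: "inj_on (insert p) ?B"
    using assms(2) by (auto simp: inj_on_def)
  have fin: "finite {Y. Y \<subseteq> A \<and> Q Y}" "finite ?B"
    using assms(1) by auto
  have "(\<Sum>Y | Y \<subseteq> insert p A \<and> Q Y. \<Prod>p\<in>Y. f p) =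
    (\<Sum>Y | Y \<subseteq> A \<and> Q Y. \<Prod>p\<in>Y. f p) + (\<Sum>Y \<in> insert p ` ?B. \<Prod>p\<in>Y. f p)"
    unfolding split using assms fin by (intro sum.union_disjoint) auto
  also have "(\<Sum>Y \<in> insert p ` ?B. \<Prod>p\<in>Y. f p) = (\<Sum>Y\<in>?B. f p * (\<Prod>p\<in>Y. f p))"
    unfolding sum.reindex[OF inj] o_def
  proof (intro sum.cong refl)
    fix Y assume "Y \<in> ?B"
    then have "finite Y" "p \<notin> Y" using assms finite_subset by auto
    then show "prod f (insert p Y) = f p * prod f Y" by simp
  qed
  finally show ?thesis by (simp add: sum_distrib_left)
qed

lemma esym_0 [simp]: "finite A \<Longrightarrow> esym 0 f A = 1"
proof -
  assume "finite A"
  then have "{Y. Y \<subseteq> A \<and> card Y = 0} = {{}}" by (auto simp: finite_subset card_eq_0_iff)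
  then show ?thesis by (simp add: esym_def)
qed

lemma esym_upto_0 [simp]: "finite A \<Longrightarrow> esym_upto 0 f A = 1"
  using esym_0[of A f] by (simp add: esym_def esym_upto_def)

lemma esym_empty: "esym n f {} = (if n = 0 then 1 else 0)"
proof -
  have "{Y :: 'a set. Y \<subseteq> {} \<and> card Y = n} = (if n = 0 then {{}} else {})" by auto
  then show ?thesis by (simp add: esym_def del: subset_empty)
qed

lemma esym_upto_empty [simp]: "esym_upto n f {} = 1"
proof -
  have "{Y :: 'a set. Y \<subseteq> {} \<and> card Y \<le> n} = {{}}" by auto
  then show ?thesis by (simp add: esym_upto_def del: subset_empty)
qed

lemma esym_insert:
  assumes "finite A" "p \<notin> A"
  shows "esym (Suc n) f (insert p A) = esym (Suc n) f A + f p * esym n f A"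
proof -
  have "{Y. Y \<subseteq> A \<and> card (insert p Y) = Suc n} = {Y. Y \<subseteq> A \<and> card Y = n}"
  proof (intro Collect_cong conj_cong refl)
    fix Y assume "Y \<subseteq> A"
    then have "finite Y" "p \<notin> Y" using assms finite_subset by auto
    then show "card (insert p Y) = Suc n \<longleftrightarrow> card Y = n" by simp
  qed
  then show ?thesis unfolding esym_def sum_subsets_insert[OF assms] by simp
qed

lemma esym_upto_insert:
  assumes "finite A" "p \<notin> A"
  shows "esym_upto (Suc n) f (insert p A) = esym_upto (Suc n) f A + f p * esym_upto n f A"
proof -
  have "{Y. Y \<subseteq> A \<and> card (insert p Y) \<le> Suc n} = {Y. Y \<subseteq> A \<and> card Y \<le> n}"
  proof (intro Collect_cong conj_cong refl)
    fix Y assume "Y \<subseteq> A"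
    then have "finite Y" "p \<notin> Y" using assms finite_subset by auto
    then show "card (insert p Y) \<le> Suc n \<longleftrightarrow> card Y \<le> n" by simp
  qed
  then show ?thesis unfolding esym_upto_def sum_subsets_insert[OF assms] by simp
qed

text \<open>The truncation error signed by \<open>(-1) ^ n\<close> satisfies
  \<open>d (Suc m) (insert p A) = d (Suc m) A + g p * d m A\<close>, the same recursion as
  \<open>esym\<close>, so both bounds pass through the induction.\<close>

lemma bonferroni:
  assumes "finite A" "\<And>p. p \<in> A \<Longrightarrow> 0 \<le> g p \<and> g p \<le> 1"
  shows "0 \<le> (-1) ^ n * (esym_upto n (\<lambda>p. - g p) A - (\<Prod>p\<in>A. 1 - g p))
    \<and> (-1) ^ n * (esym_upto n (\<lambda>p. - g p) A - (\<Prod>p\<in>A. 1 - g p)) \<le> esym (Suc n) g A"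
  using assms
proof (induction A arbitrary: n rule: finite_induct)
  case empty
  then show ?case by (simp add: esym_empty)
next
  case (insert p A)
  let ?d = "\<lambda>n A. (-1) ^ n * (esym_upto n (\<lambda>p. - g p) A - (\<Prod>p\<in>A. 1 - g p))"
  have IH: "0 \<le> ?d n A" "?d n A \<le> esym (Suc n) g A" for n
    using insert.IH[of n] insert.prems by auto
  have g: "0 \<le> g p" "g p \<le> 1" using insert.prems by auto
  show ?case
  proof (cases n)
    case 0
    have P: "0 \<le> (\<Prod>p\<in>A. 1 - g p)" "(\<Prod>p\<in>A. 1 - g p) \<le> 1"
      using insert.prems by (auto intro!: prod_nonneg prod_le_1)
    have "?d 0 (insert p A) = ?d 0 A + g p * (\<Prod>p\<in>A. 1 - g p)"
      using insert.hyps by (simp add: algebra_simps)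
    moreover have "g p * (\<Prod>p\<in>A. 1 - g p) \<le> g p * 1"
      using g P by (intro mult_left_mono) auto
    moreover have "0 \<le> g p * (\<Prod>p\<in>A. 1 - g p)" using g P by simp
    ultimately show ?thesis
      using IH[of 0] insert.hyps by (simp add: 0 esym_insert)
  next
    case (Suc m)
    have "?d (Suc m) (insert p A) = ?d (Suc m) A + g p * ?d m A"
      using insert.hyps by (simp add: esym_upto_insert algebra_simps)
    moreover have "0 \<le> g p * ?d m A" "g p * ?d m A \<le> g p * esym (Suc m) g A"
      using IH[of m] g by (auto intro!: mult_left_mono mult_nonneg_nonneg)
    ultimately show ?thesis
      using IH[of "Suc m"] insert.hyps by (auto simp: Suc esym_insert simp del: power_Suc)
  qed
qed

lemma power_add_ge:
  fixes x t :: real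
  assumes "0 \<le> x" "0 \<le> t"
  shows "t ^ Suc n + real (Suc n) * x * t ^ n \<le> (t + x) ^ Suc n"
proof (induction n)
  case (Suc n)
  have "t ^ Suc (Suc n) + real (Suc (Suc n)) * x * t ^ Suc n
    \<le> (t + x) * (t ^ Suc n + real (Suc n) * x * t ^ n)"
    using assms by (simp add: algebra_simps)
  also have "\<dots> \<le> (t + x) * (t + x) ^ Suc n"
    using assms Suc by (intro mult_left_mono) auto
  finally show ?case by simp
qed simp

text \<open>Multiplying out \<open>sum f A ^ n\<close> produces each product over an
  \<open>n\<close>-element set \<open>fact n\<close> times, and the other terms are
  nonnegative.\<close>

lemma esym_le_power:
  assumes "finite A" "\<And>p. p \<in> A \<Longrightarrow> 0 \<le> f p"
  shows "esym n f A \<le> sum f A ^ n / fact n"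
  using assms
proof (induction A arbitrary: n rule: finite_induct)
  case empty
  then show ?case by (simp add: esym_empty)
next
  case (insert p A)
  show ?case
  proof (cases n)
    case (Suc m)
    have "esym n f (insert p A) \<le> sum f A ^ Suc m / fact (Suc m) + f p * (sum f A ^ m / fact m)"
      unfolding Suc esym_insert[OF insert.hyps]
      using insert by (intro add_mono mult_left_mono) (auto simp del: power_Suc fact_Suc)
    also have "\<dots> = (sum f A ^ Suc m + real (Suc m) * f p * sum f A ^ m) / fact (Suc m)"
      by (simp add: add_divide_distrib mult.assoc del: power_Suc of_nat_Suc)
    also have "\<dots> \<le> (sum f A + f p) ^ Suc m / fact (Suc m)"
      using insert by (intro divide_right_mono power_add_ge) (auto intro!: sum_nonneg)
    finally show ?thesis using insert.hyps by (simp add: Suc add.commute)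
  qed (use insert in simp)
qed

lemma esym_upto_le_power:
  assumes "finite A" "\<And>p. p \<in> A \<Longrightarrow> 0 \<le> f p"
  shows "esym_upto n f A \<le> (1 + sum f A) ^ n"
  using assms
proof (induction A arbitrary: n rule: finite_induct)
  case (insert p A)
  show ?case
  proof (cases n)
    case (Suc m)
    have nn: "0 \<le> f p" "0 \<le> sum f A" using insert by (auto intro!: sum_nonneg)
    have "esym_upto n f (insert p A) \<le> (1 + sum f A) ^ Suc m + f p * (1 + sum f A) ^ m"
      unfolding Suc esym_upto_insert[OF insert.hyps]
      using insert nn by (intro add_mono mult_left_mono) (auto simp del: power_Suc)
    also have "\<dots> \<le> (1 + sum f A) ^ Suc m + real (Suc m) * f p * (1 + sum f A) ^ m"
      using nn by (simp add: algebra_simps)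
    also have "\<dots> \<le> (1 + sum f A + f p) ^ Suc m"
      using nn by (intro power_add_ge) auto
    finally show ?thesis using insert.hyps by (simp add: Suc add_ac)
  qed (use insert in simp)
qed simp

text \<open>The distributive law: a subset of a disjoint union is the family of its traces on the
  blocks. It turns a product of block truncations into one sum over sets of primes, which can be
  counted.\<close>

lemma sum_subsets_blocks:
  fixes f :: "'a \<Rightarrow> real"
  assumes "finite J" "\<And>j. j \<in> J \<Longrightarrow> finite (I j)" "disjoint_family_on I J"
  shows "(\<Sum>Y | Y \<subseteq> (\<Union>j\<in>J. I j) \<and> (\<forall>j\<in>J. Q j (Y \<inter> I j)). \<Prod>p\<in>Y. f p) =
    (\<Prod>j\<in>J. \<Sum>Y | Y \<subseteq> I j \<and> Q j Y. \<Prod>p\<in>Y. f p)"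
  using assms
proof (induction J rule: finite_induct)
  case empty
  have "{Y :: 'a set. Y \<subseteq> {}} = {{}}" by auto
  then show ?case by simp
next
  case (insert j J)
  let ?U = "\<Union>j\<in>J. I j"
  let ?F = "{Y. Y \<subseteq> I j \<and> Q j Y}"
  let ?G = "{Y. Y \<subseteq> ?U \<and> (\<forall>i\<in>J. Q i (Y \<inter> I i))}"
  let ?H = "{Y. Y \<subseteq> (\<Union>i\<in>insert j J. I i) \<and> (\<forall>i\<in>insert j J. Q i (Y \<inter> I i))}"
  have dis: "I j \<inter> I i = {}" if "i \<in> J" for i
    using insert.hyps that by (intro disjoint_family_onD[OF insert.prems(2)]) auto
  then have dU: "I j \<inter> ?U = {}" by auto
  have "(\<Sum>Y\<in>?H. prod f Y) = (\<Sum>(Y, Z)\<in>?F \<times> ?G. prod f Y * prod f Z)"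
  proof (rule sum.reindex_bij_witness[of _ "\<lambda>(Y, Z). Y \<union> Z" "\<lambda>Y. (Y \<inter> I j, Y \<inter> ?U)"])
    fix Y assume Y: "Y \<in> ?H"
    have *: "Y \<inter> ?U \<inter> I i = Y \<inter> I i" if "i \<in> J" for i
      using that by auto
    show "(case (Y \<inter> I j, Y \<inter> ?U) of (Y, Z) \<Rightarrow> Y \<union> Z) = Y" using Y by auto
    show "(Y \<inter> I j, Y \<inter> ?U) \<in> ?F \<times> ?G"
      using Y * by auto
    have "finite Y" using Y insert by (auto intro: finite_subset)
    have "prod f Y = prod f ((Y \<inter> I j) \<union> (Y \<inter> ?U))"
      using Y by (intro arg_cong[where f = "prod f"]) auto
    also have "\<dots> = prod f (Y \<inter> I j) * prod f (Y \<inter> ?U)"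
      using dU \<open>finite Y\<close> by (intro prod.union_disjoint) auto
    finally show "(case (Y \<inter> I j, Y \<inter> ?U) of (Y, Z) \<Rightarrow> prod f Y * prod f Z) = prod f Y" by simp
  next
    fix YZ assume YZ: "YZ \<in> ?F \<times> ?G"
    obtain Y Z where [simp]: "YZ = (Y, Z)" by force
    have YZ: "Y \<subseteq> I j" "Q j Y" "Z \<subseteq> ?U" "\<And>i. i \<in> J \<Longrightarrow> Q i (Z \<inter> I i)" using YZ by auto
    have 1: "(Y \<union> Z) \<inter> I j = Y" "(Y \<union> Z) \<inter> ?U = Z" using YZ dU by auto
    have 2: "(Y \<union> Z) \<inter> I i = Z \<inter> I i" if "i \<in> J" for i using YZ(1) dis[OF that] by auto
    show "((case YZ of (Y, Z) \<Rightarrow> Y \<union> Z) \<inter> I j, (case YZ of (Y, Z) \<Rightarrow> Y \<union> Z) \<inter> ?U) = YZ"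
      using 1 by simp
    show "(case YZ of (Y, Z) \<Rightarrow> Y \<union> Z) \<in> ?H"
      using 1 2 YZ by auto
  qed
  also have "\<dots> = (\<Sum>Y\<in>?F. prod f Y) * (\<Sum>Y\<in>?G. prod f Y)"
    by (simp add: sum_product sum.cartesian_product)
  also have "(\<Sum>Y\<in>?G. prod f Y) = (\<Prod>j\<in>J. \<Sum>Y | Y \<subseteq> I j \<and> Q j Y. prod f Y)"
    using insert by (intro insert.IH) (auto simp: disjoint_family_on_def)
  finally show ?case using insert.hyps by simp
qed

text \<open>Truncated lower bounds for single factors may be negative and cannot be multiplied.
  Instead the factors are replaced by upper bounds one at a time, each at the price of
  \<open>e j\<close> times the other upper bounds.\<close>

lemma brun_hooley:
  fixes x y e :: "'a \<Rightarrow> real"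
  assumes "finite J" "\<And>j. j \<in> J \<Longrightarrow> 0 \<le> x j \<and> x j \<le> y j \<and> y j \<le> x j + e j"
  shows "(\<Prod>j\<in>J. y j) - (\<Sum>j\<in>J. e j * (\<Prod>i\<in>J - {j}. y i)) \<le> (\<Prod>j\<in>J. x j)"
  using assms
proof (induction J rule: finite_induct)
  case (insert j J)
  have prods: "(\<Prod>j\<in>J. x j) \<le> (\<Prod>j\<in>J. y j)" "0 \<le> (\<Prod>j\<in>J. x j)"
    using insert.prems by (auto intro!: prod_mono prod_nonneg)
  have j: "0 \<le> x j" "x j \<le> y j" "y j \<le> x j + e j" using insert.prems by auto
  have "(\<Sum>i\<in>insert j J. e i * (\<Prod>k\<in>insert j J - {i}. y k)) =
    e j * (\<Prod>j\<in>J. y j) + (\<Sum>i\<in>J. e i * (\<Prod>k\<in>insert j J - {i}. y k))"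
    using insert.hyps by simp
  also have "(\<Sum>i\<in>J. e i * (\<Prod>k\<in>insert j J - {i}. y k)) = y j * (\<Sum>i\<in>J. e i * (\<Prod>k\<in>J - {i}. y k))"
    unfolding sum_distrib_left
  proof (intro sum.cong refl)
    fix i assume "i \<in> J"
    then have "insert j J - {i} = insert j (J - {i})" using insert.hyps by auto
    then show "e i * (\<Prod>k\<in>insert j J - {i}. y k) = y j * (e i * (\<Prod>k\<in>J - {i}. y k))"
      using insert.hyps by simp
  qed
  finally have *: "(\<Sum>i\<in>insert j J. e i * (\<Prod>k\<in>insert j J - {i}. y k)) =
    e j * (\<Prod>j\<in>J. y j) + y j * (\<Sum>i\<in>J. e i * (\<Prod>k\<in>J - {i}. y k))" .
  have IH: "(\<Prod>j\<in>J. y j) - (\<Sum>j\<in>J. e j * (\<Prod>i\<in>J - {j}. y i)) \<le> (\<Prod>j\<in>J. x j)"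
    using insert by auto
  have "y j * ((\<Prod>j\<in>J. y j) - (\<Sum>j\<in>J. e j * (\<Prod>i\<in>J - {j}. y i))) \<le> y j * (\<Prod>j\<in>J. x j)"
    using j by (intro mult_left_mono[OF IH]) auto
  moreover have "(y j - x j) * (\<Prod>j\<in>J. x j) \<le> e j * (\<Prod>j\<in>J. y j)"
    using j prods by (intro mult_mono) auto
  ultimately show ?case unfolding * using insert.hyps by (simp add: algebra_simps)
qed simp

section \<open>Counting residue classes\<close>

lemma periodic_add_mult:
  fixes q :: nat
  assumes "\<And>n. P (n + q) \<longleftrightarrow> P n"
  shows "P (n + i * q) \<longleftrightarrow> P n"
proof (induction i)
  case (Suc i)
  have "n + Suc i * q = (n + i * q) + q" by simp
  then show ?case using assms Suc by metis
qed simp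

lemma periodic_mod:
  fixes q :: nat
  assumes "\<And>n. P (n + q) \<longleftrightarrow> P n"
  shows "P (n mod q) \<longleftrightarrow> P n"
  using periodic_add_mult[of P q "n mod q" "n div q", OF assms] by (simp add: add.commute)

lemma card_periodic_mult:
  fixes q :: nat
  assumes "\<And>n. P (n + q) \<longleftrightarrow> P n"
  shows "card {n. n < i * q \<and> P n} = i * card {n. n < q \<and> P n}"
proof (induction i)
  case (Suc i)
  have "{n. n < Suc i * q \<and> P n} = {n. n < i * q \<and> P n} \<union> (\<lambda>n. n + i * q) ` {n. n < q \<and> P n}"
    (is "?L = ?R")
  proof (intro equalityI subsetI)
    fix n assume n: "n \<in> ?L"
    show "n \<in> ?R"
    proof (cases "n < i * q")
      case False
      then have "n = (n - i * q) + i * q" "n - i * q < q" using n by auto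
      moreover have "P (n - i * q)"
        using n periodic_add_mult[of P q "n - i * q" i, OF assms] False by auto
      ultimately show ?thesis by blast
    qed (use n in auto)
  next
    fix n assume "n \<in> ?R"
    then show "n \<in> ?L"
      using periodic_add_mult[of P q _ i, OF assms] by auto
  qed
  then have "card {n. n < Suc i * q \<and> P n} =
    card {n. n < i * q \<and> P n} + card ((\<lambda>n. n + i * q) ` {n. n < q \<and> P n})"
    by (simp only:) (intro card_Un_disjoint; auto)
  also have "card ((\<lambda>n. n + i * q) ` {n. n < q \<and> P n}) = card {n. n < q \<and> P n}"
    by (intro card_image) (auto simp: inj_on_def)
  finally show ?case using Suc by simp
qed simp

text \<open>Whole periods below and above \<open>N\<close> bracket the count. The error is the
  number \<open>c\<close> of admissible residues rather than \<open>q\<close>, which keeps the sieve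
  remainder small.\<close>

lemma card_periodic:
  fixes q N :: nat
  assumes "\<And>n. P (n + q) \<longleftrightarrow> P n" "q > 0"
  defines "c \<equiv> card {n. n < q \<and> P n}"
  shows "\<bar>real (card {n. n < N \<and> P n}) - real N / real q * real c\<bar> \<le> real c"
proof -
  let ?i = "N div q"
  have N1: "?i * q \<le> N" and N2: "N \<le> Suc ?i * q"
    using assms(2) by (auto simp: dividend_less_div_times less_imp_le)
  have "card {n. n < ?i * q \<and> P n} \<le> card {n. n < N \<and> P n}"
    using N1 by (intro card_mono) (auto simp del: div_times_less_eq_dividend dest: less_le_trans)
  then have lo: "real (?i * c) \<le> real (card {n. n < N \<and> P n})"
    unfolding c_def card_periodic_mult[of P q, OF assms(1)] of_nat_le_iff .
  have "card {n. n < N \<and> P n} \<le> card {n. n < Suc ?i * q \<and> P n}"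
    using N2 by (intro card_mono) auto
  then have hi: "real (card {n. n < N \<and> P n}) \<le> real (Suc ?i * c)"
    unfolding c_def card_periodic_mult[of P q, OF assms(1)] of_nat_le_iff .
  have "real ?i * real q \<le> real N" "real N \<le> (real ?i + 1) * real q"
    using N1 N2 by (metis of_nat_le_iff of_nat_mult, metis of_nat_Suc of_nat_le_iff of_nat_mult add.commute)
  then have "real ?i \<le> real N / real q" "real N / real q \<le> real ?i + 1"
    using assms(2) by (simp_all add: field_simps)
  then have "real ?i * real c \<le> real N / real q * real c" "real N / real q * real c \<le> (real ?i + 1) * real c"
    by (intro mult_right_mono; simp)+
  then show ?thesis using lo hi by (simp add: algebra_simps abs_le_iff)
qed

lemma card_periodic_coprime:
  fixes a b :: nat
  assumes "\<And>n. P (n + a) \<longleftrightarrow> P n" "\<And>n. Q (n + b) \<longleftrightarrow> Q n" "coprime a b" "a > 0" "b > 0"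
  shows "card {n. n < a * b \<and> P n \<and> Q n} = card {n. n < a \<and> P n} * card {n. n < b \<and> Q n}"
proof -
  let ?f = "\<lambda>n. (n mod a, n mod b)"
  have "bij_betw ?f {n. n < a * b \<and> P n \<and> Q n} ({n. n < a \<and> P n} \<times> {n. n < b \<and> Q n})"
    unfolding bij_betw_def
  proof
    show "inj_on ?f {n. n < a * b \<and> P n \<and> Q n}"
    proof (rule inj_onI)
      fix m n assume "m \<in> {n. n < a * b \<and> P n \<and> Q n}" "n \<in> {n. n < a * b \<and> P n \<and> Q n}" "?f m = ?f n"
      then have "m < a * b" "n < a * b" "[m = n] (mod a)" "[m = n] (mod b)" by (auto simp: cong_def)
      then show "m = n" using assms(3) coprime_cong_mult_nat cong_less_modulus_unique_nat by blast
    qed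
    show "?f ` {n. n < a * b \<and> P n \<and> Q n} = {n. n < a \<and> P n} \<times> {n. n < b \<and> Q n}"
    proof (intro equalityI subsetI)
      fix uv assume "uv \<in> ?f ` {n. n < a * b \<and> P n \<and> Q n}"
      then show "uv \<in> {n. n < a \<and> P n} \<times> {n. n < b \<and> Q n}"
        using assms(4,5) periodic_mod[of P a, OF assms(1)] periodic_mod[of Q b, OF assms(2)] by auto
    next
      fix uv assume uv: "uv \<in> {n. n < a \<and> P n} \<times> {n. n < b \<and> Q n}"
      obtain u v where [simp]: "uv = (u, v)" by force
      have uv: "u < a" "P u" "v < b" "Q v" using uv by auto
      obtain x where x: "x < a * b" "[x = u] (mod a)" "[x = v] (mod b)"
        using binary_chinese_remainder_unique_nat[OF assms(3), of u v] assms(4,5) by auto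
      then have "x mod a = u" "x mod b = v" using uv by (auto simp: cong_def)
      then show "uv \<in> ?f ` {n. n < a * b \<and> P n \<and> Q n}"
        using x uv periodic_mod[of P a x, OF assms(1)] periodic_mod[of Q b x, OF assms(2)] by force
    qed
  qed
  then show ?thesis by (simp add: bij_betw_same_card card_cartesian_product)
qed

lemma card_linear_cong:
  fixes q M k :: nat
  assumes "coprime M q" "q > 0"
  shows "card {m. m < q \<and> q dvd M * (m + 1) + k} = 1"
proof -
  have eq: "q dvd M * (m + 1) + k \<longleftrightarrow> [M * m + (M + k) = 0] (mod q)" for m
    by (simp add: cong_0_iff add_ac)
  obtain u where u: "[M * u = 1] (mod q)" using cong_solve_coprime_nat[OF assms(1)] by auto
  \<comment> \<open>\<open>u\<close> inverts \<open>M\<close> and \<open>q - 1\<close> plays the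
    part of \<open>-1\<close>, so \<open>t\<close> represents \<open>-(M + k) / M\<close> modulo
    \<open>q\<close>.\<close>
  define t where "t = u * (q - 1) * (M + k)"
  have "[M * t = (M * u) * ((q - 1) * (M + k))] (mod q)" by (simp add: t_def mult_ac)
  also have "[(M * u) * ((q - 1) * (M + k)) = 1 * ((q - 1) * (M + k))] (mod q)"
    by (intro cong_mult u cong_refl)
  finally have "[M * t + (M + k) = 1 * ((q - 1) * (M + k)) + (M + k)] (mod q)"
    by (rule cong_add) simp
  also have "1 * ((q - 1) * (M + k)) + (M + k) = q * (M + k)"
    using assms(2) by (cases q) auto
  finally have t: "[M * t + (M + k) = 0] (mod q)" by (simp add: cong_def)
  have "{m. m < q \<and> q dvd M * (m + 1) + k} = {t mod q}"
  proof (intro equalityI subsetI)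
    fix m assume "m \<in> {m. m < q \<and> q dvd M * (m + 1) + k}"
    then have m: "m < q" "[M * m + (M + k) = 0] (mod q)" using eq by auto
    then have "[M * m + (M + k) = M * t + (M + k)] (mod q)" using t by (simp add: cong_def)
    then have "[M * m = M * t] (mod q)" using cong_add_rcancel_nat by blast
    then have "[m = t] (mod q)" using assms(1) cong_mult_lcancel_nat by blast
    then show "m \<in> {t mod q}" using m by (simp add: cong_def)
  next
    fix m assume "m \<in> {t mod q}"
    then have m: "m = t mod q" by simp
    have "[M * m + (M + k) = M * t + (M + k)] (mod q)"
      unfolding m by (intro cong_add cong_mult cong_refl) (simp add: cong_def)
    then have "[M * m + (M + k) = 0] (mod q)" using t cong_trans by blast
    then show "m \<in> {m. m < q \<and> q dvd M * (m + 1) + k}" using eq m assms(2) by auto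
  qed
  then show ?thesis by simp
qed

text \<open>Each shift \<open>i\<close> forbids one class, and the classes differ because distinct
  shifts below \<open>p\<close> are not congruent.\<close>

lemma card_sieved_residues:
  fixes p M j :: nat
  assumes "coprime M p" "j < p"
  shows "card {m. m < p \<and> (\<exists>i\<in>{1..j}. p dvd M * (m + 1) + i)} = j"
proof -
  have "{m. m < p \<and> (\<exists>i\<in>{1..j}. p dvd M * (m + 1) + i)} =
    (\<Union>i\<in>{1..j}. {m. m < p \<and> p dvd M * (m + 1) + i})" by auto
  also have "card \<dots> = (\<Sum>i\<in>{1..j}. card {m. m < p \<and> p dvd M * (m + 1) + i})"
  proof (intro card_UN_disjoint ballI impI)
    fix i i' assume i: "i \<in> {1..j}" "i' \<in> {1..j}" "i \<noteq> i'"
    have False if m: "p dvd M * (m + 1) + i" "p dvd M * (m + 1) + i'" for m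
    proof -
      have "[M * (m + 1) + i = M * (m + 1) + i'] (mod p)"
        using m by (auto simp: cong_def mod_eq_0_iff_dvd)
      then have "[i = i'] (mod p)" using cong_add_lcancel_nat by blast
      then show False using i assms(2) by (auto simp: cong_def)
    qed
    then show "{m. m < p \<and> p dvd M * (m + 1) + i} \<inter> {m. m < p \<and> p dvd M * (m + 1) + i'} = {}"
      by auto
  qed auto
  also have "\<dots> = (\<Sum>i\<in>{1..j}. 1)"
    using assms by (intro sum.cong refl card_linear_cong) auto
  finally show ?thesis by simp
qed

section \<open>Counting under divisibility and sieve conditions together\<close>

lemma dvd_linear_periodic:
  fixes q M k m :: nat
  assumes "q dvd Q"
  shows "q dvd M * (m + Q + 1) + k \<longleftrightarrow> q dvd M * (m + 1) + k"
proof -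
  have "M * (m + Q + 1) + k = M * Q + (M * (m + 1) + k)" by (simp add: algebra_simps)
  then show ?thesis using assms by (metis dvd_add_right_iff dvd_mult)
qed

text \<open>The integer under study is \<open>n = M * (m + 1)\<close>, with \<open>m\<close> as the
  sieve variable.\<close>

definition sieved :: "nat \<Rightarrow> (nat \<Rightarrow> nat) \<Rightarrow> nat \<Rightarrow> nat \<Rightarrow> bool" where
  "sieved M \<kappa> p m \<longleftrightarrow> (\<exists>i\<in>{1..\<kappa> p}. p dvd M * (m + 1) + i)"

lemma sieved_periodic: "p dvd Q \<Longrightarrow> sieved M \<kappa> p (m + Q) \<longleftrightarrow> sieved M \<kappa> p m"
  unfolding sieved_def using dvd_linear_periodic[of p Q M m] by simp

lemma card_sieved_period:
  fixes M D k :: nat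
  assumes "finite Y" "\<And>p. p \<in> Y \<Longrightarrow> prime p \<and> \<kappa> p < p \<and> \<not> p dvd M \<and> \<not> p dvd D"
    and "coprime M D" "D > 0"
  shows "card {m. m < D * \<Prod>Y \<and> D dvd M * (m + 1) + k \<and> (\<forall>p\<in>Y. sieved M \<kappa> p m)} = (\<Prod>p\<in>Y. \<kappa> p)"
  using assms(1,2)
proof (induction Y rule: finite_induct)
  case empty
  then show ?case using card_linear_cong[OF assms(3,4)] by simp
next
  case (insert p Y)
  let ?P = "\<lambda>m. D dvd M * (m + 1) + k \<and> (\<forall>p\<in>Y. sieved M \<kappa> p m)"
  have p: "prime p" "\<kappa> p < p" "\<not> p dvd M" "\<not> p dvd D" using insert.prems by auto
  have "coprime (D * \<Prod>Y) p"
    unfolding coprime_mult_left_iff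
  proof
    show "coprime D p" using p prime_imp_coprime coprime_commute by blast
    show "coprime (\<Prod>Y) p"
    proof (rule prod_coprime_left)
      fix q assume "q \<in> Y"
      then have "prime q" "q \<noteq> p" using insert by auto
      then show "coprime q p" using p primes_coprime by blast
    qed
  qed
  moreover have "?P (m + D * \<Prod>Y) \<longleftrightarrow> ?P m" for m
    using dvd_linear_periodic[of D "D * \<Prod>Y" M m k] sieved_periodic[OF dvd_mult[OF dvd_prodI[OF insert.hyps(1), of _ "\<lambda>p. p"]], of _ M \<kappa> m D]
    by auto
  moreover have "D * \<Prod>Y > 0" using assms(4) insert by (auto intro!: prod_pos prime_gt_0_nat)
  ultimately have "card {m. m < D * \<Prod>Y * p \<and> ?P m \<and> sieved M \<kappa> p m} =
    card {m. m < D * \<Prod>Y \<and> ?P m} * card {m. m < p \<and> sieved M \<kappa> p m}"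
    using p by (intro card_periodic_coprime sieved_periodic) (auto simp: prime_gt_0_nat)
  also have "card {m. m < p \<and> sieved M \<kappa> p m} = \<kappa> p"
    unfolding sieved_def using p by (intro card_sieved_residues) (auto intro: prime_imp_coprime simp: coprime_commute[of M])
  also have "card {m. m < D * \<Prod>Y \<and> ?P m} = (\<Prod>p\<in>Y. \<kappa> p)"
    using insert by auto
  also have "{m. m < D * \<Prod>Y * p \<and> ?P m \<and> sieved M \<kappa> p m} =
    {m. m < D * \<Prod>(insert p Y) \<and> D dvd M * (m + 1) + k \<and> (\<forall>p\<in>insert p Y. sieved M \<kappa> p m)}"
    using insert.hyps by (auto simp: mult_ac)
  finally show ?case using insert.hyps by (simp add: mult.commute)
qed

lemma card_sieved:
  fixes M D k :: nat
  assumes "finite Y" "\<And>p. p \<in> Y \<Longrightarrow> prime p \<and> \<kappa> p < p \<and> \<not> p dvd M \<and> \<not> p dvd D"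
    and "coprime M D" "D > 0"
  shows "\<bar>real (card {m. m < N \<and> D dvd M * (m + 1) + k \<and> (\<forall>p\<in>Y. sieved M \<kappa> p m)})
     - real N / real D * (\<Prod>p\<in>Y. real (\<kappa> p) / real p)\<bar> \<le> (\<Prod>p\<in>Y. real (\<kappa> p))"
proof -
  let ?P = "\<lambda>m. D dvd M * (m + 1) + k \<and> (\<forall>p\<in>Y. sieved M \<kappa> p m)"
  have "?P (m + D * \<Prod>Y) \<longleftrightarrow> ?P m" for m
    using dvd_linear_periodic[of D "D * \<Prod>Y" M m k] sieved_periodic[OF dvd_mult[OF dvd_prodI[OF assms(1), of _ "\<lambda>p. p"]], of _ M \<kappa> m D]
    by auto
  moreover have "D * \<Prod>Y > 0" using assms by (auto intro!: prod_pos prime_gt_0_nat)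
  ultimately have "\<bar>real (card {m. m < N \<and> ?P m}) - real N / real (D * \<Prod>Y) * real (\<Prod>p\<in>Y. \<kappa> p)\<bar>
    \<le> real (\<Prod>p\<in>Y. \<kappa> p)"
    using card_periodic[of ?P "D * \<Prod>Y" N] card_sieved_period[OF assms] by simp
  then show ?thesis by (simp add: prod_dividef)
qed

section \<open>The Brun-Hooley sieve\<close>

lemma prod_of_bool: "finite A \<Longrightarrow> (\<Prod>p\<in>A. of_bool (P p) :: real) = of_bool (\<forall>p\<in>A. P p)"
  by (induction A rule: finite_induct) auto

lemma esym_uminus: "esym n (\<lambda>p. - f p) A = (-1) ^ n * esym n f A"
  unfolding esym_def sum_distrib_left by (intro sum.cong refl) (auto simp: prod_uminus)

text \<open>Inclusion-exclusion is truncated separately in each block of primes, at the even order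
  \<open>2 * b j\<close> in block \<open>j\<close>.\<close>

locale block_sieve =
  fixes J :: "'j set" and I :: "'j \<Rightarrow> nat set" and \<kappa> :: "nat \<Rightarrow> nat" and b :: "'j \<Rightarrow> nat" and M :: nat
  assumes finite_J: "finite J"
    and finite_I: "\<And>j. j \<in> J \<Longrightarrow> finite (I j)"
    and disjoint_I: "disjoint_family_on I J"
    and I_prime: "\<And>j p. j \<in> J \<Longrightarrow> p \<in> I j \<Longrightarrow> prime p \<and> \<kappa> p < p \<and> \<not> p dvd M"
begin

abbreviation "U \<equiv> \<Union>j\<in>J. I j"

definition g :: "nat \<Rightarrow> real" where "g p = real (\<kappa> p) / real p"

definition \<chi> :: "nat \<Rightarrow> nat \<Rightarrow> real" where "\<chi> m p = of_bool (sieved M \<kappa> p m)"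

definition T :: "nat \<Rightarrow> nat \<Rightarrow> nat \<Rightarrow> nat set" where
  "T N D k = {m. m < N \<and> D dvd M * (m + 1) + k}"

definition V :: real where "V = (\<Prod>j\<in>J. \<Prod>p\<in>I j. 1 - g p)"

text \<open>Bounds the accumulated rounding error: a set of sieving primes costs at most the product
  of its \<open>\<kappa> p\<close>, and at most \<open>2 * b j + 1\<close> primes come from block
  \<open>j\<close>, the extra one on account of \<open>er\<close>.\<close>

definition rem :: real where "rem = (\<Prod>j\<in>J. (1 + (\<Sum>p\<in>I j. real (\<kappa> p))) ^ (2 * b j + 1))"

text \<open>Even truncation overestimates the product of \<open>1 - f p\<close>, by at most the
  first omitted order \<open>er\<close>. Both are taken at the indicators \<open>\<chi> m\<close>
  for single integers and at the densities \<open>g\<close> for averages.\<close>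

definition up :: "(nat \<Rightarrow> real) \<Rightarrow> 'j \<Rightarrow> real" where
  "up f j = esym_upto (2 * b j) (\<lambda>p. - f p) (I j)"

definition er :: "(nat \<Rightarrow> real) \<Rightarrow> 'j \<Rightarrow> real" where
  "er f j = esym (2 * b j + 1) f (I j)"

lemma \<chi>_bounds: "0 \<le> \<chi> m p \<and> \<chi> m p \<le> 1"
  by (simp add: \<chi>_def)

lemma rem_nonneg: "0 \<le> rem"
  unfolding rem_def by (intro prod_nonneg zero_le_power add_nonneg_nonneg sum_nonneg) auto

lemma finite_U: "finite U"
  using finite_J finite_I by auto

lemma finite_T: "finite (T N D k)"
  unfolding T_def by auto

lemma g_bounds: "j \<in> J \<Longrightarrow> p \<in> I j \<Longrightarrow> 0 \<le> g p \<and> g p < 1"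
  using I_prime[of j p] by (auto simp: g_def)

text \<open>Expanding the product over blocks gives one sum over sets \<open>Y\<close>, and summing
  over \<open>m\<close> turns indicators into densities by \<open>card_sieved\<close>. The free
  predicate \<open>Q\<close> serves the upper truncations and the Brun-Hooley corrections
  alike.\<close>

lemma card_family:
  assumes "\<And>p. p \<in> U \<Longrightarrow> \<not> p dvd D" "coprime M D" "D > 0"
    and Q: "\<And>j Y. j \<in> J \<Longrightarrow> Q j Y \<Longrightarrow> card Y \<le> 2 * b j + 1"
  defines "B \<equiv> \<lambda>f. \<Prod>j\<in>J. \<Sum>Y | Y \<subseteq> I j \<and> Q j Y. \<Prod>p\<in>Y. f p"
  shows "\<bar>(\<Sum>m\<in>T N D k. B (\<lambda>p. - \<chi> m p)) - real N / real D * B (\<lambda>p. - g p)\<bar> \<le> rem"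
proof -
  let ?F = "{Y. Y \<subseteq> U \<and> (\<forall>j\<in>J. Q j (Y \<inter> I j))}"
  let ?c = "\<lambda>Y. real (card {m. m < N \<and> D dvd M * (m + 1) + k \<and> (\<forall>p\<in>Y. sieved M \<kappa> p m)})"
  have B: "B f = (\<Sum>Y\<in>?F. \<Prod>p\<in>Y. f p)" for f
    unfolding B_def using finite_J finite_I disjoint_I by (rule sum_subsets_blocks[symmetric])
  have count: "(\<Sum>m\<in>T N D k. \<Prod>p\<in>Y. - \<chi> m p) = (-1) ^ card Y * ?c Y" if "Y \<in> ?F" for Y
  proof -
    have "finite Y" using that finite_U finite_subset by blast
    have "(\<Sum>m\<in>T N D k. \<Prod>p\<in>Y. - \<chi> m p) =
      (-1) ^ card Y * (\<Sum>m\<in>T N D k. of_bool (\<forall>p\<in>Y. sieved M \<kappa> p m))"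
      unfolding sum_distrib_left \<chi>_def prod_uminus prod_of_bool[OF \<open>finite Y\<close>] ..
    also have "(\<Sum>m\<in>T N D k. of_bool (\<forall>p\<in>Y. sieved M \<kappa> p m) :: real) =
       real (card (T N D k \<inter> {m. \<forall>p\<in>Y. sieved M \<kappa> p m}))"
      using finite_T by (subst sum_of_bool_eq) auto
    also have "T N D k \<inter> {m. \<forall>p\<in>Y. sieved M \<kappa> p m} =
       {m. m < N \<and> D dvd M * (m + 1) + k \<and> (\<forall>p\<in>Y. sieved M \<kappa> p m)}"
      unfolding T_def by auto
    finally show ?thesis .
  qed
  have "(\<Sum>m\<in>T N D k. B (\<lambda>p. - \<chi> m p)) = (\<Sum>Y\<in>?F. \<Sum>m\<in>T N D k. \<Prod>p\<in>Y. - \<chi> m p)"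
    unfolding B by (rule sum.swap)
  also have "\<dots> = (\<Sum>Y\<in>?F. (-1) ^ card Y * ?c Y)"
    using count by (intro sum.cong) auto
  finally have "(\<Sum>m\<in>T N D k. B (\<lambda>p. - \<chi> m p)) - real N / real D * B (\<lambda>p. - g p)
    = (\<Sum>Y\<in>?F. (-1) ^ card Y * (?c Y - real N / real D * (\<Prod>p\<in>Y. g p)))"
    unfolding B by (simp add: prod_uminus sum_distrib_left sum_subtractf algebra_simps)
  also have "\<bar>\<dots>\<bar> \<le> (\<Sum>Y\<in>?F. \<Prod>p\<in>Y. real (\<kappa> p))"
  proof (rule order.trans[OF sum_abs], rule sum_mono)
    fix Y assume Y: "Y \<in> ?F"
    have "finite Y" using Y finite_U finite_subset by blast
    then have "\<bar>?c Y - real N / real D * (\<Prod>p\<in>Y. g p)\<bar> \<le> (\<Prod>p\<in>Y. real (\<kappa> p))"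
      unfolding g_def using Y I_prime assms(1-3) by (intro card_sieved) blast+
    then show "\<bar>(-1) ^ card Y * (?c Y - real N / real D * (\<Prod>p\<in>Y. g p))\<bar> \<le> (\<Prod>p\<in>Y. real (\<kappa> p))"
      by (simp add: abs_mult power_abs)
  qed
  also have "\<dots> = (\<Prod>j\<in>J. \<Sum>Y | Y \<subseteq> I j \<and> Q j Y. \<Prod>p\<in>Y. real (\<kappa> p))"
    using B[of "\<lambda>p. real (\<kappa> p)"] by (simp add: B_def)
  also have "\<dots> \<le> (\<Prod>j\<in>J. esym_upto (2 * b j + 1) (\<lambda>p. real (\<kappa> p)) (I j))"
    unfolding esym_upto_def using Q finite_I
    by (intro prod_mono conjI sum_nonneg prod_nonneg sum_mono2) auto
  also have "\<dots> \<le> rem"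
    unfolding rem_def using finite_I
    by (intro prod_mono conjI esym_upto_le_power) (auto simp: esym_upto_def intro!: sum_nonneg prod_nonneg)
  finally show ?thesis .
qed

lemma card_up:
  assumes "\<And>p. p \<in> U \<Longrightarrow> \<not> p dvd D" "coprime M D" "D > 0"
  shows "\<bar>(\<Sum>m\<in>T N D k. \<Prod>j\<in>J. up (\<chi> m) j) - real N / real D * (\<Prod>j\<in>J. up g j)\<bar> \<le> rem"
  using card_family[OF assms, where Q = "\<lambda>j Y. card Y \<le> 2 * b j" and N = N and k = k]
  by (simp add: up_def esym_upto_def)

lemma card_er:
  assumes "\<And>p. p \<in> U \<Longrightarrow> \<not> p dvd D" "coprime M D" "D > 0" "i \<in> J"
  shows "\<bar>(\<Sum>m\<in>T N D k. er (\<chi> m) i * (\<Prod>j\<in>J - {i}. up (\<chi> m) j))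
    - real N / real D * (er g i * (\<Prod>j\<in>J - {i}. up g j))\<bar> \<le> rem"
proof -
  \<comment> \<open>Block \<open>i\<close> uses exactly the first omitted order, every other block
    the even truncation; as that order is odd, the family sum is minus the wanted product.\<close>
  let ?Q = "\<lambda>j Y. if j = i then card Y = 2 * b j + 1 else card (Y :: nat set) \<le> 2 * b j"
  have *: "(\<Prod>j\<in>J. \<Sum>Y | Y \<subseteq> I j \<and> ?Q j Y. \<Prod>p\<in>Y. - f p) = - (er f i * (\<Prod>j\<in>J - {i}. up f j))" for f
  proof -
    have "(\<Prod>j\<in>J - {i}. \<Sum>Y | Y \<subseteq> I j \<and> ?Q j Y. \<Prod>p\<in>Y. - f p) = (\<Prod>j\<in>J - {i}. up f j)"
      unfolding up_def esym_upto_def by (intro prod.cong) auto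
    moreover have "(\<Sum>Y | Y \<subseteq> I i \<and> ?Q i Y. \<Prod>p\<in>Y. - f p) = - er f i"
      using esym_uminus[of "2 * b i + 1" f "I i"] by (simp add: er_def esym_def)
    ultimately show ?thesis
      using prod.remove[OF finite_J assms(4), of "\<lambda>j. \<Sum>Y | Y \<subseteq> I j \<and> ?Q j Y. \<Prod>p\<in>Y. - f p"] by simp
  qed
  have "\<bar>- ((\<Sum>m\<in>T N D k. er (\<chi> m) i * (\<Prod>j\<in>J - {i}. up (\<chi> m) j))
    - real N / real D * (er g i * (\<Prod>j\<in>J - {i}. up g j)))\<bar> \<le> rem"
    using card_family[OF assms(1-3), where Q = ?Q and N = N and k = k]
    unfolding * by (simp add: sum_negf split: if_splits)
  then show ?thesis by (simp only: abs_minus_cancel)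
qed

lemma up_er_bounds:
  assumes "j \<in> J" "\<And>p. p \<in> I j \<Longrightarrow> 0 \<le> f p \<and> f p \<le> 1"
  shows "0 \<le> (\<Prod>p\<in>I j. 1 - f p)" "(\<Prod>p\<in>I j. 1 - f p) \<le> up f j"
    "up f j \<le> (\<Prod>p\<in>I j. 1 - f p) + er f j"
  using bonferroni[OF finite_I[OF assms(1)], of f "2 * b j"] assms(2)
  by (auto simp: up_def er_def intro!: prod_nonneg)

lemma prod_unsieved: "(\<Prod>j\<in>J. \<Prod>p\<in>I j. 1 - \<chi> m p) = of_bool (\<forall>p\<in>U. \<not> sieved M \<kappa> p m)"
proof -
  have "(\<Prod>j\<in>J. \<Prod>p\<in>I j. 1 - \<chi> m p) = (\<Prod>j\<in>J. of_bool (\<forall>p\<in>I j. \<not> sieved M \<kappa> p m))"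
    using finite_I by (intro prod.cong refl) (simp add: \<chi>_def prod_of_bool flip: of_bool_not_iff)
  also have "\<dots> = of_bool (\<forall>p\<in>U. \<not> sieved M \<kappa> p m)"
    by (simp add: prod_of_bool finite_J)
  finally show ?thesis .
qed

lemma sum_unsieved:
  "(\<Sum>m\<in>T N D k. \<Prod>j\<in>J. \<Prod>p\<in>I j. 1 - \<chi> m p) =
    real (card {m. m < N \<and> D dvd M * (m + 1) + k \<and> (\<forall>p\<in>U. \<not> sieved M \<kappa> p m)})"
proof -
  have "T N D k \<inter> {m. \<forall>p\<in>U. \<not> sieved M \<kappa> p m} =
    {m. m < N \<and> D dvd M * (m + 1) + k \<and> (\<forall>p\<in>U. \<not> sieved M \<kappa> p m)}"
    unfolding T_def by auto
  then show ?thesis unfolding prod_unsieved by (subst sum_of_bool_eq) (auto simp: finite_T)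
qed

lemma V_pos: "0 < V"
  unfolding V_def using g_bounds by (intro prod_pos) auto

text \<open>Each \<open>up g j\<close> exceeds the true factor at most by the factor
  \<open>1 + \<epsilon> j \<le> exp (\<epsilon> j)\<close>.\<close>

theorem sieve_upper:
  assumes "\<And>p. p \<in> U \<Longrightarrow> \<not> p dvd D" "coprime M D" "D > 0"
    and \<epsilon>: "\<And>j. j \<in> J \<Longrightarrow> er g j \<le> \<epsilon> j * (\<Prod>p\<in>I j. 1 - g p)"
  shows "real (card {m. m < N \<and> D dvd M * (m + 1) + k \<and> (\<forall>p\<in>U. \<not> sieved M \<kappa> p m)})
    \<le> real N / real D * (exp (sum \<epsilon> J) * V) + rem"
proof -
  have "(\<Prod>j\<in>J. up g j) \<le> (\<Prod>j\<in>J. exp (\<epsilon> j) * (\<Prod>p\<in>I j. 1 - g p))"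
  proof (intro prod_mono conjI)
    fix j assume j: "j \<in> J"
    note b = up_er_bounds[OF j, of g]
    have "0 \<le> g p \<and> g p \<le> 1" if "p \<in> I j" for p using g_bounds[OF j that] by auto
    note b = b[OF this]
    show "0 \<le> up g j" using b by auto
    have "up g j \<le> (1 + \<epsilon> j) * (\<Prod>p\<in>I j. 1 - g p)"
      using b \<epsilon>[OF j] by (auto simp: algebra_simps)
    also have "\<dots> \<le> exp (\<epsilon> j) * (\<Prod>p\<in>I j. 1 - g p)"
      using b exp_ge_add_one_self[of "\<epsilon> j"] by (intro mult_right_mono) auto
    finally show "up g j \<le> exp (\<epsilon> j) * (\<Prod>p\<in>I j. 1 - g p)" .
  qed
  also have "\<dots> = exp (sum \<epsilon> J) * V"
    by (simp add: prod.distrib exp_sum finite_J V_def)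
  finally have up: "(\<Prod>j\<in>J. up g j) \<le> exp (sum \<epsilon> J) * V" .
  have "(\<Sum>m\<in>T N D k. \<Prod>j\<in>J. \<Prod>p\<in>I j. 1 - \<chi> m p) \<le> (\<Sum>m\<in>T N D k. \<Prod>j\<in>J. up (\<chi> m) j)"
    using up_er_bounds(1,2)[OF _ \<chi>_bounds] by (intro sum_mono prod_mono conjI)
  also have "\<dots> \<le> real N / real D * (\<Prod>j\<in>J. up g j) + rem"
    using card_up[OF assms(1-3), where N = N and k = k] by linarith
  also have "\<dots> \<le> real N / real D * (exp (sum \<epsilon> J) * V) + rem"
    using up by (intro add_right_mono mult_left_mono) auto
  finally show ?thesis unfolding sum_unsieved .
qed

text \<open>The Brun-Hooley inequality is applied to the indicators of each \<open>m\<close> and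
  then summed. The main product and each of the \<open>card J\<close> corrections contribute one
  \<open>rem\<close>.\<close>

theorem sieve_lower:
  assumes \<epsilon>: "\<And>j. j \<in> J \<Longrightarrow> er g j \<le> \<epsilon> j * (\<Prod>p\<in>I j. 1 - g p)"
    and \<epsilon>_nonneg: "\<And>j. j \<in> J \<Longrightarrow> 0 \<le> \<epsilon> j" and \<epsilon>_sum: "sum \<epsilon> J \<le> 1"
  shows "real N * ((1 - sum \<epsilon> J) * V) - (1 + real (card J)) * rem
    \<le> real (card {m. m < N \<and> (\<forall>p\<in>U. \<not> sieved M \<kappa> p m)})"
proof -
  have D: "\<And>p. p \<in> U \<Longrightarrow> \<not> p dvd 1" "coprime M 1" "(1::nat) > 0"
    using I_prime by (auto dest: prime_gt_1_nat)
  note up = card_up[OF D, where N = N and k = 0] and er = card_er[OF D, where N = N and k = 0]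
  have b: "0 \<le> (\<Prod>p\<in>I j. 1 - g p)" "(\<Prod>p\<in>I j. 1 - g p) \<le> up g j" if "j \<in> J" for j
    using up_er_bounds[OF that, of g] g_bounds[OF that] less_imp_le by blast+
  have "(1 - sum \<epsilon> J) * V \<le> (1 - sum \<epsilon> J) * (\<Prod>j\<in>J. up g j)"
    unfolding V_def using b \<epsilon>_sum by (intro mult_left_mono prod_mono) auto
  also have "\<dots> = (\<Prod>j\<in>J. up g j) - (\<Sum>j\<in>J. \<epsilon> j * (\<Prod>i\<in>J. up g i))"
    by (simp add: sum_distrib_right algebra_simps)
  also have "\<dots> \<le> (\<Prod>j\<in>J. up g j) - (\<Sum>j\<in>J. er g j * (\<Prod>i\<in>J - {j}. up g i))"
  proof (intro diff_left_mono sum_mono)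
    fix j assume j: "j \<in> J"
    have "er g j \<le> \<epsilon> j * up g j"
      using \<epsilon>[OF j] b[OF j] \<epsilon>_nonneg[OF j] by (meson mult_left_mono order_trans)
    then have "er g j * (\<Prod>i\<in>J - {j}. up g i) \<le> \<epsilon> j * up g j * (\<Prod>i\<in>J - {j}. up g i)"
      using b order_trans by (intro mult_right_mono prod_nonneg) fastforce+
    then show "er g j * (\<Prod>i\<in>J - {j}. up g i) \<le> \<epsilon> j * (\<Prod>i\<in>J. up g i)"
      by (simp add: prod.remove[OF finite_J j] mult.assoc)
  qed
  finally have main: "real N * ((1 - sum \<epsilon> J) * V) \<le>
    real N * ((\<Prod>j\<in>J. up g j) - (\<Sum>j\<in>J. er g j * (\<Prod>i\<in>J - {j}. up g i)))"
    by (intro mult_left_mono) auto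
  have "(\<Sum>j\<in>J. \<Sum>m\<in>T N 1 0. er (\<chi> m) j * (\<Prod>i\<in>J - {j}. up (\<chi> m) i))
    \<le> (\<Sum>j\<in>J. real N * (er g j * (\<Prod>i\<in>J - {j}. up g i)) + rem)"
  proof (intro sum_mono)
    fix j assume "j \<in> J"
    then show "(\<Sum>m\<in>T N 1 0. er (\<chi> m) j * (\<Prod>i\<in>J - {j}. up (\<chi> m) i))
      \<le> real N * (er g j * (\<Prod>i\<in>J - {j}. up g i)) + rem"
      using er[of j] by simp
  qed
  then have "(\<Sum>m\<in>T N 1 0. \<Sum>j\<in>J. er (\<chi> m) j * (\<Prod>i\<in>J - {j}. up (\<chi> m) i))
    \<le> real N * (\<Sum>j\<in>J. er g j * (\<Prod>i\<in>J - {j}. up g i)) + real (card J) * rem"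
    by (subst sum.swap) (simp add: sum.distrib sum_distrib_left)
  moreover have "real N * (\<Prod>j\<in>J. up g j) - rem \<le> (\<Sum>m\<in>T N 1 0. \<Prod>j\<in>J. up (\<chi> m) j)"
    using up by simp
  ultimately have "real N * ((1 - sum \<epsilon> J) * V) - (1 + real (card J)) * rem \<le>
    (\<Sum>m\<in>T N 1 0. (\<Prod>j\<in>J. up (\<chi> m) j) - (\<Sum>j\<in>J. er (\<chi> m) j * (\<Prod>i\<in>J - {j}. up (\<chi> m) i)))"
    using main by (simp add: sum_subtractf algebra_simps)
  also have "\<dots> \<le> (\<Sum>m\<in>T N 1 0. \<Prod>j\<in>J. \<Prod>p\<in>I j. 1 - \<chi> m p)"
    using up_er_bounds[OF _ \<chi>_bounds] by (intro sum_mono brun_hooley finite_J conjI)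
  finally show ?thesis unfolding sum_unsieved by simp
qed

end

section \<open>Reciprocals of primes\<close>

lemma prod_coprime_dvd:
  fixes n :: nat
  assumes "finite P" "\<And>p. p \<in> P \<Longrightarrow> p dvd n" "\<And>p q. p \<in> P \<Longrightarrow> q \<in> P \<Longrightarrow> p \<noteq> q \<Longrightarrow> coprime p q"
  shows "\<Prod>P dvd n"
  using assms
proof (induction P rule: finite_induct)
  case (insert p P)
  then have "coprime p (\<Prod>P)" by (intro prod_coprime_right) auto
  then show ?case using insert by (simp add: divides_mult)
qed simp

text \<open>Chebyshev's argument: with \<open>n = 2 ^ a\<close>, every prime in
  \<open>(n, 2 * n]\<close> divides the central binomial coefficient, which is at most
  \<open>4 ^ n\<close>, while each such prime exceeds \<open>n\<close>.\<close>

lemma card_primes_dyadic: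
  "a * card {p. prime p \<and> 2 ^ a < p \<and> p \<le> (2::nat) ^ Suc a} \<le> 2 ^ Suc a"
proof -
  let ?P = "{p. prime p \<and> 2 ^ a < p \<and> p \<le> (2::nat) ^ Suc a}"
  let ?n = "(2::nat) ^ a"
  have fin: "finite ?P" by (rule finite_subset[of _ "{..2 ^ Suc a}"]) auto
  have "p dvd (2 * ?n) choose ?n" if p: "p \<in> ?P" for p
  proof -
    have "fact ?n * fact (2 * ?n - ?n) * ((2 * ?n) choose ?n) = (fact (2 * ?n) :: nat)"
      by (intro binomial_fact_lemma) simp
    moreover have "p dvd fact (2 * ?n)" "\<not> p dvd fact ?n" using p by (auto simp: prime_dvd_fact_iff)
    ultimately have "p dvd fact ?n * fact ?n * ((2 * ?n) choose ?n)" by simp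
    then show "p dvd (2 * ?n) choose ?n"
      using p \<open>\<not> p dvd fact ?n\<close> by (auto simp: prime_dvd_mult_iff)
  qed
  then have "\<Prod>?P dvd (2 * ?n) choose ?n"
    using fin by (intro prod_coprime_dvd) (auto intro: primes_coprime)
  then have "\<Prod>?P \<le> (2 * ?n) choose ?n" by (intro dvd_imp_le) (auto simp: zero_less_binomial_iff)
  also have "\<dots> \<le> 2 ^ (2 * ?n)" by (rule binomial_le_pow2)
  finally have "\<Prod>?P \<le> 2 ^ (2 * ?n)" .
  moreover have "?n ^ card ?P \<le> \<Prod>?P"
    using prod_mono[of ?P "\<lambda>_. ?n" "\<lambda>p. p"] by auto
  ultimately have "(2::nat) ^ (a * card ?P) \<le> 2 ^ (2 * ?n)"
    by (simp add: power_mult)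
  then have "a * card ?P \<le> 2 * ?n" by (rule power_le_imp_le_exp[rotated]) simp
  then show ?thesis by simp
qed

section \<open>Reciprocal sums over dyadic and squared ranges\<close>

definition recip_sum :: "nat \<Rightarrow> nat \<Rightarrow> real" where
  "recip_sum x y = (\<Sum>p | prime p \<and> x < p \<and> p \<le> y. 1 / real p)"

lemma recip_sum_split:
  assumes "x \<le> y" "y \<le> z"
  shows "recip_sum x z = recip_sum x y + recip_sum y z"
proof -
  have "{p. prime p \<and> x < p \<and> p \<le> z} = {p. prime p \<and> x < p \<and> p \<le> y} \<union> {p. prime p \<and> y < p \<and> p \<le> z}"
    using assms by auto
  then show ?thesis unfolding recip_sum_def
    by (simp only:) (intro sum.union_disjoint, auto)
qed

lemma recip_sum_self [simp]: "recip_sum x x = 0"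
proof -
  have "{p. prime p \<and> x < p \<and> p \<le> x} = {}" by auto
  then show ?thesis by (simp only: recip_sum_def sum.empty)
qed

lemma recip_sum_mono:
  assumes "x' \<le> x" "y \<le> y'"
  shows "recip_sum x y \<le> recip_sum x' y'"
  unfolding recip_sum_def using assms by (intro sum_mono2) (auto intro: finite_subset[of _ "{..y'}"])

lemma recip_sum_dyadic:
  assumes "a > 0"
  shows "recip_sum (2 ^ a) (2 ^ Suc a) \<le> 2 / real a"
proof -
  let ?P = "{p. prime p \<and> 2 ^ a < p \<and> p \<le> (2::nat) ^ Suc a}"
  have "recip_sum (2 ^ a) (2 ^ Suc a) \<le> (\<Sum>p\<in>?P. 1 / 2 ^ a)"
    unfolding recip_sum_def
  proof (intro sum_mono)
    fix p assume "p \<in> ?P"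
    then have "2 ^ a < p" by simp
    then have "(2::real) ^ a \<le> real p" by (metis less_imp_le of_nat_le_iff of_nat_numeral of_nat_power)
    then show "1 / real p \<le> 1 / 2 ^ a" by (intro divide_left_mono mult_pos_pos) (auto intro: less_le_trans[of 0 "2 ^ a"])
  qed
  also have "\<dots> = real (card ?P) / 2 ^ a" by simp
  also have "\<dots> \<le> 2 / real a"
  proof -
    have "real (a * card ?P) \<le> real (2 ^ Suc a)" using card_primes_dyadic[of a] of_nat_le_iff by blast
    then show ?thesis using assms by (simp add: field_simps)
  qed
  finally show ?thesis .
qed

text \<open>There are \<open>a\<close> dyadic intervals, each contributing at most
  \<open>2 / a\<close>. Squaring the upper limit thus costs a constant, which is the form in which
  doubly logarithmic growth is used.\<close>

lemma recip_sum_square: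
  assumes "a > 0"
  shows "recip_sum (2 ^ a) (2 ^ (2 * a)) \<le> 2"
proof -
  have "recip_sum (2 ^ a) (2 ^ (a + i)) \<le> real i * (2 / real a)" for i
  proof (induction i)
    case (Suc i)
    have "recip_sum (2 ^ a) (2 ^ (a + Suc i)) = recip_sum (2 ^ a) (2 ^ (a + i)) + recip_sum (2 ^ (a + i)) (2 ^ Suc (a + i))"
      by (subst recip_sum_split[of _ "2 ^ (a + i)"]) auto
    also have "\<dots> \<le> real i * (2 / real a) + 2 / real (a + i)"
      using assms by (intro add_mono Suc recip_sum_dyadic) auto
    also have "2 / real (a + i) \<le> 2 / real a" using assms by (intro divide_left_mono) auto
    finally show ?case by (simp add: algebra_simps add_divide_distrib)
  qed (simp add: recip_sum_self)
  from this[of a] show ?thesis using assms by (simp add: mult_2)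
qed

lemma recip_sum_iterated_square:
  assumes "a > 0"
  shows "recip_sum (2 ^ a) (2 ^ (a * 2 ^ i)) \<le> 2 * real i"
proof (induction i)
  case (Suc i)
  have "recip_sum (2 ^ a) (2 ^ (a * 2 ^ Suc i)) =
    recip_sum (2 ^ a) (2 ^ (a * 2 ^ i)) + recip_sum (2 ^ (a * 2 ^ i)) (2 ^ (a * 2 ^ Suc i))"
    using assms by (intro recip_sum_split power_increasing) auto
  also have "recip_sum (2 ^ (a * 2 ^ i)) (2 ^ (a * 2 ^ Suc i)) \<le> 2"
    using recip_sum_square[of "a * 2 ^ i"] assms by (simp add: mult_ac)
  finally show ?case using Suc by simp
qed (simp add: recip_sum_self)

lemma sum_inverse_squares:
  fixes a :: nat
  assumes "a > 0"
  shows "(\<Sum>d\<in>{a<..c}. 1 / (real d)\<^sup>2) \<le> 1 / real a"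
proof (cases "a \<le> c")
  case True
  have "(\<Sum>d\<in>{a<..c}. 1 / (real d)\<^sup>2) \<le> 1 / real a - 1 / real c"
    using True
  proof (induction c rule: dec_induct)
    case (step n)
    have "{a<..Suc n} = insert (Suc n) {a<..n}" using step by auto
    then have "(\<Sum>d\<in>{a<..Suc n}. 1 / (real d)\<^sup>2) \<le> 1 / (real (Suc n))\<^sup>2 + (1 / real a - 1 / real n)"
      using step by simp
    moreover have "1 / (real (Suc n))\<^sup>2 \<le> 1 / real n - 1 / real (Suc n)"
    proof -
      have "1 / real n - 1 / real (Suc n) = 1 / (real n * real (Suc n))"
        using step assms by (simp add: field_simps)
      also have "\<dots> \<ge> 1 / (real (Suc n) * real (Suc n))"
        using step assms by (intro divide_left_mono mult_right_mono) auto
      finally show ?thesis by (simp add: power2_eq_square)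
    qed
    ultimately show ?case by simp
  qed simp
  then show ?thesis using divide_nonneg_nonneg[of 1 "real c"] by linarith
qed simp

section \<open>Prime factors in prescribed sets\<close>

definition Omega_on :: "nat set \<Rightarrow> nat \<Rightarrow> nat" where
  "Omega_on A m = (\<Sum>p\<in>prime_factors m \<inter> A. multiplicity p m)"

lemma Omega_on_UNIV: "Omega_on UNIV m = Omega m"
  by (simp add: Omega_on_def Omega_def)

lemma Omega_on_Un: "Omega_on (A \<union> B) m \<le> Omega_on A m + Omega_on B m"
proof -
  have "Omega_on (A \<union> B) m \<le> Omega_on (A \<union> B) m + (\<Sum>p\<in>prime_factors m \<inter> A \<inter> (prime_factors m \<inter> B). multiplicity p m)"
    by simp
  also have "\<dots> = Omega_on A m + Omega_on B m"
    unfolding Omega_on_def Int_Un_distrib by (intro sum.union_inter) auto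
  finally show ?thesis .
qed

text \<open>The part of \<open>m\<close> composed of primes in \<open>A\<close> divides
  \<open>m\<close>. Taking \<open>x = 2\<close> bounds \<open>Omega\<close> by a logarithm; a large
  \<open>x\<close> limits the number of large prime factors.\<close>

lemma power_Omega_on_le:
  assumes "m > 0" "\<And>p. p \<in> A \<Longrightarrow> prime p \<Longrightarrow> x \<le> p"
  shows "x ^ Omega_on A m \<le> m"
proof -
  have "x ^ Omega_on A m = (\<Prod>p\<in>prime_factors m \<inter> A. x ^ multiplicity p m)"
    by (simp add: Omega_on_def power_sum)
  also have "\<dots> \<le> (\<Prod>p\<in>prime_factors m \<inter> A. p ^ multiplicity p m)"
    using assms(2) by (intro prod_mono) (auto intro: power_mono)
  also have "\<dots> \<le> (\<Prod>p\<in>prime_factors m. p ^ multiplicity p m)"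
    by (intro dvd_imp_le prod_dvd_prod_subset) (auto intro!: prod_pos simp: prime_gt_0_nat dest: in_prime_factors_imp_prime)
  also have "\<dots> = m" using assms(1) by (rule prime_factorization_nat[symmetric])
  finally show ?thesis .
qed

lemma Omega_le_log: "0 < m \<Longrightarrow> m \<le> 2 ^ k \<Longrightarrow> Omega m \<le> k"
proof -
  assume m: "0 < m" "m \<le> 2 ^ k"
  have "2 ^ Omega_on UNIV m \<le> m" using m(1) prime_ge_2_nat by (rule power_Omega_on_le)
  also note m(2)
  finally have "(2::nat) ^ Omega m \<le> 2 ^ k" by (simp only: Omega_on_UNIV)
  then show ?thesis by (rule power_le_imp_le_exp[rotated]) simp
qed

section \<open>Comparison of the three arithmetic functions\<close>

lemma omega_le_Omega: "omega m \<le> Omega m"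
proof -
  have "(\<Sum>p\<in>prime_factors m. 1) \<le> (\<Sum>p\<in>prime_factors m. multiplicity p m)"
    by (intro sum_mono) (auto simp: prime_factors_multiplicity)
  then show ?thesis by (simp add: omega_def Omega_def)
qed

lemma Omega_eq_size: "Omega m = size (prime_factorization m)"
  unfolding Omega_def size_multiset_overloaded_eq
  by (intro sum.cong refl) (auto simp: count_prime_factorization)

text \<open>A divisor of \<open>p * m\<close> divides \<open>m\<close> or is \<open>p\<close> times
  a divisor of \<open>m\<close>, so each prime factor at most doubles the count.\<close>

lemma tau_le: "m > 0 \<Longrightarrow> tau m \<le> 2 ^ Omega m"
proof (induction m rule: prime_divisors_induct)
  case (factor p m)
  have p: "prime p" and m: "m > 0" using factor by auto
  have "{d. d dvd p * m} \<subseteq> {d. d dvd m} \<union> (*) p ` {d. d dvd m}"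
  proof
    fix d assume d: "d \<in> {d. d dvd p * m}"
    show "d \<in> {d. d dvd m} \<union> (*) p ` {d. d dvd m}"
    proof (cases "p dvd d")
      case True
      then obtain e where "d = p * e" by blast
      then show ?thesis using d p by (auto simp: prime_gt_0_nat)
    next
      case False
      then have "coprime d p" using p prime_imp_coprime coprime_commute by blast
      then show ?thesis using d by (simp add: coprime_dvd_mult_right_iff)
    qed
  qed
  then have "tau (p * m) \<le> card ({d. d dvd m} \<union> (*) p ` {d. d dvd m})"
    unfolding tau_def using m by (intro card_mono) auto
  also have "\<dots> \<le> card {d. d dvd m} + card ((*) p ` {d. d dvd m})" by (rule card_Un_le)
  also have "\<dots> \<le> tau m + tau m"
    unfolding tau_def using m by (intro add_mono card_image_le) auto
  also have "\<dots> \<le> 2 ^ Suc (Omega m)" using factor.IH m by simp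
  also have "Suc (Omega m) = Omega (p * m)"
    unfolding Omega_eq_size using m p
    by (subst prime_factorization_mult) (auto simp: prime_factorization_prime)
  finally show ?case .
qed (auto simp: tau_def)

text \<open>Used to lower exponents until their total is exactly a prescribed
  \<open>k\<close>.\<close>

lemma sum_decrease:
  fixes v :: "'a \<Rightarrow> nat"
  assumes "finite A" "k \<le> sum v A"
  shows "\<exists>u. (\<forall>a\<in>A. u a \<le> v a) \<and> sum u A = k"
  using assms
proof (induction A arbitrary: k rule: finite_induct)
  case (insert a A)
  obtain u where u: "\<forall>a\<in>A. u a \<le> v a" "sum u A = min k (sum v A)"
    using insert.IH[of "min k (sum v A)"] by auto
  have "sum (u(a := k - min k (sum v A))) A = sum u A"
    using insert.hyps by (intro sum.cong) auto
  then have "(\<forall>b\<in>insert a A. (u(a := k - min k (sum v A))) b \<le> v b) \<and>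
    sum (u(a := k - min k (sum v A))) (insert a A) = k"
    using u insert by auto
  then show ?case by blast
qed simp

lemma power_lt_prod_power:
  fixes u :: "nat \<Rightarrow> nat"
  assumes "finite A" "\<And>p. p \<in> A \<Longrightarrow> y < p" "0 < sum u A"
  shows "y ^ sum u A < (\<Prod>p\<in>A. p ^ u p)"
proof -
  have "y ^ sum u A < (Suc y) ^ sum u A" using assms(3) by (intro power_strict_mono) auto
  also have "\<dots> = (\<Prod>p\<in>A. Suc y ^ u p)" by (simp add: power_sum)
  also have "\<dots> \<le> (\<Prod>p\<in>A. p ^ u p)"
    using assms(2) by (intro prod_mono) (auto intro!: power_mono simp: Suc_le_eq)
  finally show ?thesis .
qed

text \<open>A multiplicity \<open>v\<close> is at most \<open>1 + 2 * (v div 2)\<close>. If the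
  halves add up to \<open>k\<close> or more, some product \<open>d\<close> of exactly
  \<open>k\<close> primes of \<open>A\<close>, with repetition, has its square dividing
  \<open>m\<close>, and such a \<open>d\<close> lies in the excluded range.\<close>

lemma Omega_on_le_square_part:
  assumes "m > 0" "k > 0" and A: "\<And>p. p \<in> A \<Longrightarrow> prime p \<and> y < p \<and> p \<le> w"
    and nosq: "\<And>d. d\<^sup>2 dvd m \<Longrightarrow> y ^ k < d \<Longrightarrow> d \<le> w ^ k \<Longrightarrow> prime_factors d \<subseteq> A \<Longrightarrow>
      card (prime_factors d) \<le> k \<Longrightarrow> False"
  shows "Omega_on A m \<le> card {p\<in>A. p dvd m} + 2 * k"
proof -
  let ?F = "prime_factors m \<inter> A"
  have F: "?F = {p\<in>A. p dvd m}" using assms(1) A by (auto simp: prime_factors_dvd)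
  have "(\<Sum>p\<in>?F. multiplicity p m div 2) < k"
  proof (rule ccontr)
    assume "\<not> (\<Sum>p\<in>?F. multiplicity p m div 2) < k"
    then obtain u where u: "\<forall>p\<in>?F. u p \<le> multiplicity p m div 2" "sum u ?F = k"
      using sum_decrease[of ?F k "\<lambda>p. multiplicity p m div 2"] by auto
    define d where "d = (\<Prod>p\<in>?F. p ^ u p)"
    have "d\<^sup>2 = (\<Prod>p\<in>?F. p ^ (2 * u p))"
      by (simp add: d_def prod_power_distrib mult.commute flip: power_mult)
    also have "\<dots> dvd (\<Prod>p\<in>?F. p ^ multiplicity p m)"
    proof (intro prod_dvd_prod le_imp_power_dvd)
      fix p assume "p \<in> ?F"
      then have "u p \<le> multiplicity p m div 2" using u(1) by blast
      then show "2 * u p \<le> multiplicity p m" by simp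
    qed
    also have "\<dots> dvd (\<Prod>p\<in>prime_factors m. p ^ multiplicity p m)"
      by (intro prod_dvd_prod_subset) auto
    also have "\<dots> = m" using assms(1) by (rule prime_factorization_nat[symmetric])
    finally have 1: "d\<^sup>2 dvd m" .
    have 2: "y ^ k < d"
      unfolding d_def u(2)[symmetric] using A u(2) assms(2) by (intro power_lt_prod_power) auto
    have "d \<le> (\<Prod>p\<in>?F. w ^ u p)"
      unfolding d_def using A by (intro prod_mono) (auto intro: power_mono)
    also have "\<dots> = w ^ k" by (simp add: u(2)[symmetric] power_sum)
    finally have 3: "d \<le> w ^ k" .
    have pf: "prime_factors d \<subseteq> {p\<in>?F. u p > 0}"
    proof
      fix q assume q: "q \<in> prime_factors d"
      then have "prime q" "q dvd (\<Prod>p\<in>?F. p ^ u p)" by (auto simp: d_def)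
      then obtain p where p: "p \<in> ?F" "q dvd p ^ u p" by (auto simp: prime_dvd_prod_iff)
      then have "u p > 0" using \<open>prime q\<close> by (intro gr0I) auto
      moreover have "q dvd p" using \<open>prime q\<close> p(2) by (rule prime_dvd_power)
      moreover have "prime p" using A p(1) by simp
      ultimately have "0 < u p" "q = p" using \<open>prime q\<close> by (auto intro: primes_dvd_imp_eq)
      then show "q \<in> {p\<in>?F. u p > 0}" using p by auto
    qed
    have "card (prime_factors d) \<le> card {p\<in>?F. u p > 0}" using pf by (intro card_mono) auto
    also have "\<dots> = (\<Sum>p\<in>{p\<in>?F. u p > 0}. 1)" by simp
    also have "\<dots> \<le> (\<Sum>p\<in>{p\<in>?F. u p > 0}. u p)" by (intro sum_mono) auto
    also have "\<dots> \<le> sum u ?F" by (intro sum_mono2) auto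
    finally have 4: "card (prime_factors d) \<le> k" using u(2) by simp
    have "prime_factors d \<subseteq> A" using pf by auto
    then show False using nosq 1 2 3 4 by blast
  qed
  moreover have "Omega_on A m \<le> (\<Sum>p\<in>?F. 1 + 2 * (multiplicity p m div 2))"
    unfolding Omega_on_def by (intro sum_mono) presburger
  moreover have "\<dots> = card ?F + 2 * (\<Sum>p\<in>?F. multiplicity p m div 2)"
    unfolding sum.distrib sum_distrib_left by simp
  ultimately show ?thesis unfolding F by linarith
qed

text \<open>Since \<open>k < 2 ^ e \<le> p ^ e\<close>, the multiplicity of \<open>p\<close> in
  \<open>k\<close> is below \<open>e\<close>, and adding the multiple \<open>n\<close> of
  \<open>p ^ e\<close> does not raise it. The total is at most
  \<open>Omega k \<le> k\<close>.\<close>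

lemma Omega_on_small_le:
  assumes "k > 0" "k < 2 ^ e" "\<And>p. p \<in> A \<Longrightarrow> prime p \<Longrightarrow> p ^ e dvd n"
  shows "Omega_on A (n + k) \<le> k"
proof -
  have "Omega_on A (n + k) \<le> (\<Sum>p\<in>prime_factors (n + k) \<inter> A. multiplicity p k)"
    unfolding Omega_on_def
  proof (intro sum_mono)
    fix p assume p: "p \<in> prime_factors (n + k) \<inter> A"
    then have pr: "prime p" by auto
    define v where "v = multiplicity p k"
    have "p ^ v dvd k" unfolding v_def by (rule multiplicity_dvd)
    then have "p ^ v \<le> k" using assms(1) by (intro dvd_imp_le)
    moreover have "2 ^ v \<le> p ^ v" using pr by (intro power_mono) (auto dest: prime_ge_2_nat)
    ultimately have "(2::nat) ^ v < 2 ^ e" using assms(2) by linarith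
    then have "Suc v \<le> e" by (simp add: Suc_le_eq)
    then have "p ^ Suc v dvd p ^ e" by (rule le_imp_power_dvd)
    also have "p ^ e dvd n" using assms(3) p pr by auto
    finally have "p ^ Suc v dvd n" .
    moreover have "\<not> p ^ Suc v dvd k"
      using power_dvd_iff_le_multiplicity[of k p "Suc v"] assms(1) not_prime_unit[of p] pr
      unfolding v_def by linarith
    ultimately have "\<not> p ^ Suc v dvd n + k" by (simp only: dvd_add_right_iff not_False_eq_True)
    then have "\<not> Suc v \<le> multiplicity p (n + k)" using multiplicity_dvd' by blast
    then show "multiplicity p (n + k) \<le> multiplicity p k" by (simp add: v_def)
  qed
  also have "\<dots> = (\<Sum>p\<in>prime_factors (n + k) \<inter> A \<inter> prime_factors k. multiplicity p k)"
    using assms(1)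
    by (intro sum.mono_neutral_right) (auto intro!: not_dvd_imp_multiplicity_0 simp: in_prime_factors_iff)
  also have "\<dots> \<le> Omega k" unfolding Omega_def by (intro sum_mono2) auto
  also have "\<dots> \<le> k" using assms(1) by (intro Omega_le_log) (auto intro: less_imp_le)
  finally show ?thesis .
qed

section \<open>Choice of parameters\<close>

lemma exp_le_one_minus:
  fixes x :: real
  assumes "0 \<le> x" "x \<le> 1 / 2"
  shows "exp (- 2 * x) \<le> 1 - x"
proof -
  have "x * x \<le> x * (1 / 2)" using assms by (intro mult_left_mono)
  then have "- 2 * x \<le> - x - 2 * x\<^sup>2" by (simp add: power2_eq_square)
  also have "\<dots> \<le> ln (1 - x)" using assms by (intro ln_one_minus_pos_lower_bound) auto
  finally have "exp (- 2 * x) \<le> exp (ln (1 - x))" by simp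
  then show ?thesis using assms by simp
qed

lemma power_over_fact_le_exp:
  fixes x :: real
  assumes "0 \<le> x"
  shows "x ^ n / fact n \<le> exp x"
proof -
  have "summable (\<lambda>k. x ^ k /\<^sub>R fact k)" using exp_converges sums_summable by blast
  then have "(\<Sum>k\<in>{n}. x ^ k /\<^sub>R fact k) \<le> (\<Sum>k. x ^ k /\<^sub>R fact k)"
    using assms by (intro sum_le_suminf) auto
  then show ?thesis by (simp add: exp_def divide_inverse mult.commute)
qed

lemma exp_of_nat_le: "exp (real n) \<le> 3 ^ n"
  using power_mono[OF exp_le, of n] exp_of_nat_mult[of n "1 :: real"] by simp

text \<open>Adds up dimension times logarithmic size over the blocks for \<open>rem_le\<close>:
  halving the logarithms outweighs the linear growth in \<open>j\<close>.\<close>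

lemma sum_mult_power2: "(\<Sum>j = 1..K. j * 2 ^ (Suc K - j)) + 2 * (K + 2) = (2::nat) ^ (K + 2)"
proof (induction K)
  case (Suc K)
  have "(\<Sum>j = 1..K. j * 2 ^ (Suc (Suc K) - j)) = 2 * (\<Sum>j = 1..K. j * 2 ^ (Suc K - j))"
    unfolding sum_distrib_left by (intro sum.cong refl) (auto simp: Suc_diff_le)
  then show ?case using Suc by simp
qed simp

lemma sum_powers_le:
  fixes x :: real
  assumes "0 \<le> x" "x < 1"
  shows "(\<Sum>j = 1..n. x ^ j) \<le> x / (1 - x)"
proof -
  have "(\<Sum>j = 1..n. x ^ j) \<le> x / (1 - x) * (1 - x ^ n)"
  proof (induction n)
    case (Suc n)
    have "(\<Sum>j = 1..Suc n. x ^ j) \<le> x / (1 - x) * (1 - x ^ n) + x ^ Suc n" using Suc by simp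
    also have "\<dots> = x / (1 - x) * (1 - x ^ Suc n)" using assms by (simp add: field_simps)
    finally show ?case .
  qed simp
  also have "\<dots> \<le> x / (1 - x) * 1" using assms by (intro mult_left_mono) auto
  finally show ?thesis by simp
qed

text \<open>
  Every size is a power of the base \<open>y = 2 ^ s\<close>. The integers considered are \<open>n = M * (m + 1)\<close> with
  \<open>m < N\<close>, where the high power of \<open>y!\<close> in \<open>M\<close> ensures that the primes up to \<open>y\<close> contribute the
  same to \<open>n + k\<close> as to \<open>k\<close>. The set \<open>S\<close> consists of the \<open>m\<close> such that, for \<open>1 \<le> k \<le> K\<close>, the number
  \<open>n + k\<close> has no prime factor in \<open>(y, z k]\<close>; a prime \<open>p\<close> thus forbids \<open>\<kappa> p\<close> residue classes, and
  \<open>\<kappa> = j\<close> on the block \<open>I j\<close>. Since subtraction truncates, \<open>z j = y\<close> for all \<open>j > K\<close>. The sieve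
  density is \<open>V {}\<close>, and \<open>V B\<close> is the density when the primes in \<open>B\<close> are left out.
\<close>

locale scale =
  fixes s :: nat
  assumes s: "8 \<le> s"
begin

text \<open>Then \<open>X = 2 * y\<^sup>2\<close>, large enough for \<open>M \<le> N\<close> and for
  \<open>V_ge\<close>, while \<open>K\<close> stays far below the sieving primes.\<close>

definition K :: nat where "K = 2 * s"
definition X :: nat where "X = 2 ^ (K + 1)"
definition y :: nat where "y = 2 ^ s"
text \<open>As powers of \<open>y\<close>, the remainder is at most \<open>y ^ (68 * X)\<close>, the
  divisors \<open>D\<close> are at most \<open>y ^ (2 * X)\<close> and the density is at least
  \<open>1 / y ^ X\<close>; the exponent \<open>128 * X\<close> leaves room for all three.\<close>

definition N :: nat where "N = 2 ^ (128 * (s * X))"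
text \<open>The exponent satisfies \<open>256 * (s * X) < 2 ^ (3 * s + 9)\<close>, which covers
  every \<open>k\<close> not settled by the size of \<open>n + k\<close> alone.\<close>

definition M :: nat where "M = fact y ^ (3 * s + 9)"
definition z :: "nat \<Rightarrow> nat" where "z j = 2 ^ (s * 2 ^ (K + 1 - j))"
text \<open>Chosen so that \<open>w k ^ k \<le> y ^ X\<close>: a product of \<open>k\<close> primes
  up to \<open>w k\<close>, and even its square, is small enough to serve as a sieve divisor
  \<open>D\<close>.\<close>

definition w :: "nat \<Rightarrow> nat" where "w k = 2 ^ (s * (X div k))"
definition I :: "nat \<Rightarrow> nat set" where "I j = {p. prime p \<and> z (Suc j) < p \<and> p \<le> z j}"
definition \<kappa> :: "nat \<Rightarrow> nat" where "\<kappa> p = card {j\<in>{1..K}. p \<le> z j}"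
definition V :: "nat set \<Rightarrow> real" where
  "V B = (\<Prod>j\<in>{1..K}. \<Prod>p\<in>I j - B. 1 - real (\<kappa> p) / real p)"
definition S :: "nat set" where
  "S = {m. m < N \<and> (\<forall>p\<in>(\<Union>j\<in>{1..K}. I j). \<not> sieved M \<kappa> p m)}"

section \<open>Sizes of the sieving ranges\<close>

lemma z_antimono: "i \<le> j \<Longrightarrow> z j \<le> z i"
  unfolding z_def by (intro power_increasing mult_left_mono) auto

lemma y_le_z: "y \<le> z j"
  unfolding y_def z_def using s by (intro power_increasing) auto

lemma small_le_y: "16 * s \<le> y" "256 \<le> y"
proof -
  show "16 * s \<le> y" unfolding y_def using s
  proof (induction s rule: dec_induct)
    case (step n)
    then show ?case by simp
  qed simp
  have "(2::nat) ^ 8 \<le> y" unfolding y_def using s by (intro power_increasing) auto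
  then show "256 \<le> y" by simp
qed

lemma finite_I: "finite (I j)"
  unfolding I_def by (rule finite_subset[of _ "{..z j}"]) auto

lemma I_gt_y: "p \<in> I j \<Longrightarrow> y < p"
  unfolding I_def using y_le_z[of "Suc j"] by auto

text \<open>As \<open>z\<close> is antitone, the shifts at which \<open>p\<close> must be avoided
  form an initial segment, so that \<open>sieved\<close> can record them by their number.\<close>

lemma kappa_I:
  assumes "j \<in> {1..K}" "p \<in> I j"
  shows "\<kappa> p = j"
proof -
  have "{i\<in>{1..K}. p \<le> z i} = {1..j}"
  proof (intro equalityI subsetI)
    fix i assume i: "i \<in> {i\<in>{1..K}. p \<le> z i}"
    have "\<not> Suc j \<le> i"
      using z_antimono[of "Suc j" i] i assms(2) unfolding I_def by force
    then show "i \<in> {1..j}" using i by auto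
  next
    fix i assume i: "i \<in> {1..j}"
    then show "i \<in> {i\<in>{1..K}. p \<le> z i}"
      using z_antimono[of i j] assms unfolding I_def by force
  qed
  then show ?thesis by (simp add: \<kappa>_def)
qed

lemma not_dvd_M:
  assumes "prime p" "y < p"
  shows "\<not> p dvd M"
  using assms prime_dvd_power[of p "fact y" "3 * s + 9"] by (auto simp: M_def prime_dvd_fact_iff)

lemma g_le:
  assumes "j \<in> {1..K}" "p \<in> I j"
  shows "real (\<kappa> p) / real p \<le> 1 / 2"
proof -
  have "2 * \<kappa> p \<le> p"
    using kappa_I[OF assms] I_gt_y[OF assms(2)] small_le_y assms(1) by (auto simp: K_def)
  then have "2 * real (\<kappa> p) \<le> real p" by (metis of_nat_le_iff of_nat_mult of_nat_numeral)
  then show ?thesis using I_gt_y[OF assms(2)] by (simp add: field_simps)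
qed

lemma I_disjoint: "i < j \<Longrightarrow> I i \<inter> I j = {}"
  unfolding I_def using z_antimono[of "Suc i" j] by fastforce

lemma disjoint_I: "disjoint_family_on (\<lambda>j. I j - B) J"
  unfolding disjoint_family_on_def
proof (intro ballI impI)
  fix i j :: nat assume "i \<noteq> j"
  then show "(I i - B) \<inter> (I j - B) = {}"
    using I_disjoint[of i j] I_disjoint[of j i] by (cases "i < j") auto
qed

lemma block_sieve: "block_sieve {1..K} (\<lambda>j. I j - B) \<kappa> M"
proof
  fix j p assume j: "j \<in> {1..K}" "p \<in> I j - B"
  then have "prime p" "y < p" using I_gt_y by (auto simp: I_def)
  moreover have "\<kappa> p < p"
    using kappa_I[of j p] small_le_y \<open>y < p\<close> j by (auto simp: K_def)
  ultimately show "prime p \<and> \<kappa> p < p \<and> \<not> p dvd M" using not_dvd_M by blast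
qed (auto intro: disjoint_I finite_I)

lemma recip_sum_z: "recip_sum (z k) (2 ^ (s * X)) \<le> 2 * real k"
proof -
  \<comment> \<open>From \<open>z k\<close> to \<open>y ^ X\<close> takes \<open>k\<close>
    squarings, but never more than \<open>K + 1\<close>, since \<open>z\<close> stays at
    \<open>y\<close> beyond that index.\<close>
  define i where "i = min k (K + 1)"
  have "K + 1 - k + i = K + 1" by (auto simp: i_def)
  then have *: "s * 2 ^ (K + 1 - k) * 2 ^ i = s * X"
    by (simp add: X_def mult.assoc flip: power_add)
  have "recip_sum (z k) (2 ^ (s * X)) \<le> 2 * real i"
    using recip_sum_iterated_square[of "s * 2 ^ (K + 1 - k)" i] s unfolding * by (simp add: z_def)
  moreover have "2 * real i \<le> 2 * real k" by (simp add: i_def)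
  ultimately show ?thesis by linarith
qed

lemma recip_sum_I:
  assumes "j \<in> {1..K}"
  shows "recip_sum (z (Suc j)) (z j) \<le> 2"
proof -
  define a where "a = s * 2 ^ (K + 1 - Suc j)"
  have "K + 1 - j = Suc (K + 1 - Suc j)" using assms by auto
  then have "z j = 2 ^ (2 * a)" "z (Suc j) = 2 ^ a" by (simp_all add: z_def a_def mult_ac)
  moreover have "a > 0" using s by (simp add: a_def)
  ultimately show ?thesis using recip_sum_square[of a] by simp
qed

section \<open>Densities, truncation errors and remainder of the blocks\<close>

lemma sum_g_le:
  assumes "j \<in> {1..K}"
  shows "(\<Sum>p\<in>I j - B. real (\<kappa> p) / real p) \<le> 2 * real j"
proof -
  have "(\<Sum>p\<in>I j - B. real (\<kappa> p) / real p) \<le> (\<Sum>p\<in>I j. real (\<kappa> p) / real p)"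
    using finite_I by (intro sum_mono2) auto
  also have "\<dots> = real j * recip_sum (z (Suc j)) (z j)"
    unfolding recip_sum_def sum_distrib_left I_def[symmetric]
    using kappa_I[OF assms] by (intro sum.cong refl) auto
  also have "\<dots> \<le> real j * 2" by (intro mult_left_mono recip_sum_I assms) auto
  finally show ?thesis by simp
qed

lemma prod_g_ge:
  assumes "j \<in> {1..K}"
  shows "exp (- 4 * real j) \<le> (\<Prod>p\<in>I j - B. 1 - real (\<kappa> p) / real p)"
proof -
  have "exp (- 4 * real j) \<le> exp (\<Sum>p\<in>I j - B. - 2 * (real (\<kappa> p) / real p))"
    using sum_g_le[OF assms, of B] unfolding sum_distrib_left[symmetric] by simp
  also have "\<dots> = (\<Prod>p\<in>I j - B. exp (- 2 * (real (\<kappa> p) / real p)))"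
    using finite_I by (intro exp_sum) auto
  also have "\<dots> \<le> (\<Prod>p\<in>I j - B. 1 - real (\<kappa> p) / real p)"
    using g_le[OF assms] by (intro prod_mono conjI exp_le_one_minus) auto
  finally show ?thesis .
qed

text \<open>The densities in the block sum to at most \<open>2 * j\<close>, and the product of
  \<open>1 - \<kappa> p / p\<close> is at least \<open>exp (- 4 * j)\<close>; at order
  \<open>16 * j + 1\<close> the factorial overcomes both.\<close>

lemma esym_g_le:
  assumes "j \<in> {1..K}"
  shows "esym (16 * j + 1) (\<lambda>p. real (\<kappa> p) / real p) (I j - B)
    \<le> (1 / 4) ^ j * (\<Prod>p\<in>I j - B. 1 - real (\<kappa> p) / real p)"
proof -
  let ?g = "\<lambda>p. real (\<kappa> p) / real p"
  have "esym (16 * j + 1) ?g (I j - B) \<le> (\<Sum>p\<in>I j - B. ?g p) ^ (16 * j + 1) / fact (16 * j + 1)"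
    using finite_I by (intro esym_le_power) auto
  also have "\<dots> \<le> (2 * real j) ^ (16 * j + 1) / fact (16 * j + 1)"
    using sum_g_le[OF assms, of B] by (intro divide_right_mono power_mono sum_nonneg) auto
  \<comment> \<open>The inserted \<open>4\<close> makes one term of the exponential series bound
    \<open>x ^ n / fact n\<close> by \<open>exp (4 * x) / 4 ^ n\<close>.\<close>
  also have "\<dots> = (4 * (2 * real j)) ^ (16 * j + 1) / fact (16 * j + 1) / 4 ^ (16 * j + 1)"
  proof -
    have *: "a ^ n / c = (4 * a) ^ n / c / 4 ^ n" for a c :: real and n
      unfolding power_mult_distrib by simp
    show ?thesis by (rule *)
  qed
  also have "\<dots> \<le> exp (4 * (2 * real j)) / 4 ^ (16 * j + 1)"
    by (intro divide_right_mono power_over_fact_le_exp) auto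
  also have "exp (4 * (2 * real j)) = exp (12 * real j) * exp (- 4 * real j)"
    by (simp flip: exp_add)
  also have "exp (12 * real j) * exp (- 4 * real j) / 4 ^ (16 * j + 1)
    \<le> 4 ^ (15 * j + 1) * exp (- 4 * real j) / 4 ^ (16 * j + 1)"
  proof (intro divide_right_mono mult_right_mono)
    have "exp (12 * real j) \<le> 3 ^ (12 * j)" using exp_of_nat_le[of "12 * j"] by simp
    also have "\<dots> \<le> 4 ^ (12 * j)" by (intro power_mono) auto
    also have "\<dots> \<le> (4::real) ^ (15 * j + 1)" by (intro power_increasing) auto
    finally show "exp (12 * real j) \<le> 4 ^ (15 * j + 1)" .
  qed auto
  also have "\<dots> = (1 / 4) ^ j * exp (- 4 * real j)"
  proof -
    have "(4::real) ^ (16 * j + 1) = 4 ^ (15 * j + 1) * 4 ^ j"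
      by (simp flip: power_add)
    then show ?thesis by (simp add: power_one_over)
  qed
  also have "\<dots> \<le> (1 / 4) ^ j * (\<Prod>p\<in>I j - B. 1 - ?g p)"
    by (intro mult_left_mono prod_g_ge assms) auto
  finally show ?thesis .
qed

text \<open>In block \<open>j\<close> the base is at most the square of \<open>z j\<close> and the
  exponent at most \<open>17 * j\<close>, hence \<open>34 * j\<close> factors \<open>z j\<close>. As
  powers of \<open>y\<close> these add up to at most \<open>34 * (2 * X)\<close>.\<close>

lemma rem_le: "(\<Prod>j\<in>{1..K}. (1 + (\<Sum>p\<in>I j - B. real (\<kappa> p))) ^ (16 * j + 1)) \<le> 2 ^ (68 * (s * X))"
proof -
  have "(\<Prod>j\<in>{1..K}. (1 + (\<Sum>p\<in>I j - B. real (\<kappa> p))) ^ (16 * j + 1))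
    \<le> (\<Prod>j\<in>{1..K}. 2 ^ (34 * s * (j * 2 ^ (Suc K - j))))"
  proof (intro prod_mono conjI zero_le_power add_nonneg_nonneg sum_nonneg)
    fix j assume j: "j \<in> {1..K}"
    have "(\<Sum>p\<in>I j - B. \<kappa> p) \<le> (\<Sum>p\<in>I j. \<kappa> p)"
      using finite_I by (intro sum_mono2) auto
    also have "\<dots> = card (I j) * j" using kappa_I[OF j] by simp
    also have "\<dots> \<le> z j * K"
    proof (intro mult_mono)
      have "card (I j) \<le> card {1..z j}" unfolding I_def
        by (intro card_mono) (auto dest: prime_gt_0_nat)
      then show "card (I j) \<le> z j" by simp
    qed (use j in auto)
    finally have "1 + (\<Sum>p\<in>I j - B. \<kappa> p) \<le> z j * 1 + z j * K"
      using y_le_z[of j] small_le_y by simp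
    also have "\<dots> = z j * (1 + K)" by (simp add: algebra_simps)
    also have "\<dots> \<le> z j * z j"
      using y_le_z[of j] small_le_y s by (intro mult_left_mono) (auto simp: K_def)
    finally have "real (1 + (\<Sum>p\<in>I j - B. \<kappa> p)) \<le> real (z j * z j)" by (simp only: of_nat_le_iff)
    then have "(1 + (\<Sum>p\<in>I j - B. real (\<kappa> p))) ^ (16 * j + 1) \<le> real (z j * z j) ^ (16 * j + 1)"
      by (intro power_mono add_nonneg_nonneg sum_nonneg) auto
    also have "\<dots> \<le> real (z j * z j) ^ (17 * j)"
      using j y_le_z[of j] small_le_y by (intro power_increasing) (auto simp flip: of_nat_mult)
    also have "\<dots> = 2 ^ (34 * s * (j * 2 ^ (Suc K - j)))"
      by (simp add: z_def mult_ac flip: power_mult power_add)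
    finally show "(1 + (\<Sum>p\<in>I j - B. real (\<kappa> p))) ^ (16 * j + 1) \<le> 2 ^ (34 * s * (j * 2 ^ (Suc K - j)))" .
  qed auto
  also have "\<dots> = 2 ^ (34 * s * (\<Sum>j = 1..K. j * 2 ^ (Suc K - j)))"
    by (simp add: power_sum sum_distrib_left)
  also have "\<dots> \<le> 2 ^ (34 * s * (2 * X))"
    using sum_mult_power2[of K] by (intro power_increasing mult_left_mono) (auto simp: X_def)
  finally show ?thesis by (simp add: mult_ac)
qed

lemma sum_quarter: "(\<Sum>j\<in>{1..K}. (1 / 4 :: real) ^ j) \<le> 1 / 3"
  using sum_powers_le[of "1 / 4" K] by simp

text \<open>The blocks contribute at least \<open>exp (- 4 * j)\<close> each, in all
  \<open>exp (- 2 * K * (K + 1))\<close>; this exponent is polynomial in \<open>s\<close>, whereas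
  \<open>X\<close> is exponential.\<close>

lemma V_ge: "(1 / 2) ^ (s * X) \<le> V B"
proof -
  have A: "8 * (2 * n + 1) \<le> (2::nat) ^ (2 * n + 1)" if "8 \<le> n" for n
    using that by (induction n rule: dec_induct) auto
  have "(1 / 2) ^ (s * X) \<le> (1 / 2 :: real) ^ (4 * (K * (K + 1)))"
  proof (intro power_decreasing)
    have "4 * (K * (K + 1)) = s * (8 * (2 * s + 1))" by (simp add: K_def algebra_simps)
    also have "\<dots> \<le> s * X" unfolding X_def K_def by (intro mult_left_mono A s) auto
    finally show "4 * (K * (K + 1)) \<le> s * X" .
  qed auto
  also have "\<dots> = (1 / 4) ^ (2 * (K * (K + 1)))"
    using power_mult[of "1 / 2 :: real" 2 "2 * (K * (K + 1))"] by (simp add: power2_eq_square)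
  also have "\<dots> \<le> (1 / exp 1) ^ (2 * (K * (K + 1)))"
    using exp_le by (intro power_mono divide_left_mono) auto
  also have "\<dots> = exp (- 2 * (real K * (real K + 1)))"
    using exp_of_nat_mult[of "2 * (K * (K + 1))" "- 1 :: real"]
    by (simp add: exp_minus inverse_eq_divide algebra_simps)
  also have "\<dots> = (\<Prod>j\<in>{1..K}. exp (- 4 * real j))"
  proof -
    have "(\<Sum>j = 1..n. real j) = real n * (real n + 1) / 2" for n
      by (induction n) (auto simp: field_simps)
    note gauss = this[of K]
    have "(\<Sum>j = 1..K. - 4 * real j) = - 2 * (real K * (real K + 1))"
      unfolding sum_distrib_left[symmetric] gauss by simp
    then show ?thesis by (simp add: exp_sum[symmetric])
  qed
  also have "\<dots> \<le> V B"
    unfolding V_def using prod_g_ge by (intro prod_mono) auto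
  finally show ?thesis .
qed

lemma V_pos: "0 < V B"
  using V_ge[of B] less_le_trans[of 0 "(1 / 2 :: real) ^ (s * X)"] by simp

lemma V_remove:
  assumes "finite B"
  shows "V B \<le> 2 ^ card B * V {}"
proof -
  let ?g = "\<lambda>p. real (\<kappa> p) / real p" and ?U = "\<Union>j\<in>{1..K}. I j"
  have VU: "V C = (\<Prod>p\<in>?U - C. 1 - ?g p)" for C
  proof -
    have "(\<Union>j\<in>{1..K}. I j - C) = ?U - C" by auto
    moreover have "(\<Prod>p\<in>(\<Union>j\<in>{1..K}. I j - C). 1 - ?g p) = V C"
      unfolding V_def using finite_I disjoint_I[of C "{1..K}"]
      by (intro prod.UNION_disjoint) (auto simp: disjoint_family_on_def)
    ultimately show ?thesis by simp
  qed
  have finU: "finite ?U" using finite_I by auto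
  have half: "1 / 2 \<le> 1 - ?g p" if "p \<in> ?U" for p
    using that g_le by force
  have "V {} = (\<Prod>p\<in>?U - B. 1 - ?g p) * (\<Prod>p\<in>?U \<inter> B. 1 - ?g p)"
    unfolding VU using finU by (subst prod.union_disjoint[symmetric]) (auto intro!: prod.cong)
  then have V0: "V {} = V B * (\<Prod>p\<in>?U \<inter> B. 1 - ?g p)" by (simp only: VU)
  have "(1 / 2) ^ card B \<le> (1 / 2 :: real) ^ card (?U \<inter> B)"
    using assms by (intro power_decreasing card_mono) auto
  also have "\<dots> = (\<Prod>p\<in>?U \<inter> B. 1 / 2)" by simp
  also have "\<dots> \<le> (\<Prod>p\<in>?U \<inter> B. 1 - ?g p)" using half by (intro prod_mono) auto
  finally have "V B * (1 / 2) ^ card B \<le> V {}"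
    unfolding V0 using V_pos[of B] by (intro mult_left_mono) auto
  then show ?thesis by (simp add: power_one_over field_simps)
qed

lemma N_V_ge: "2 ^ (127 * (s * X)) \<le> real N * V B"
proof -
  have "(2::real) ^ (127 * (s * X)) = real N * (1 / 2) ^ (s * X)"
    using power_add[of "2::real" "127 * (s * X)" "s * X"]
    by (simp add: N_def power_one_over field_simps)
  also have "\<dots> \<le> real N * V B" by (intro mult_left_mono V_ge) auto
  finally show ?thesis .
qed

text \<open>The truncation errors \<open>(1 / 4) ^ j\<close> sum to at most \<open>1 / 3\<close>,
  leaving two thirds of \<open>N * V {}\<close>, and the remainder takes at most a sixth.\<close>

lemma card_S_ge: "real N * V {} / 2 \<le> real (card S)"
proof -
  have b2: "2 * (8 * j) = 16 * j" for j :: nat by simp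
  interpret bs: block_sieve "{1..K}" "\<lambda>j. I j - {}" \<kappa> "\<lambda>j. 8 * j" M by (rule block_sieve)
  have V: "bs.V = V {}" unfolding bs.V_def V_def bs.g_def ..
  have rem: "bs.rem \<le> 2 ^ (68 * (s * X))" using rem_le[of "{}"] unfolding bs.rem_def by (simp only: b2)
  have er: "bs.er bs.g j \<le> (1 / 4) ^ j * (\<Prod>p\<in>I j - {}. 1 - bs.g p)" if "j \<in> {1..K}" for j
    using esym_g_le[OF that, of "{}"] unfolding bs.er_def bs.g_def by simp
  have "real N * ((1 - (\<Sum>j\<in>{1..K}. (1 / 4) ^ j)) * bs.V) - (1 + real (card {1..K})) * bs.rem
    \<le> real (card {m. m < N \<and> (\<forall>p\<in>bs.U. \<not> sieved M \<kappa> p m)})"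
    using er sum_quarter by (intro bs.sieve_lower) auto
  moreover have "{m. m < N \<and> (\<forall>p\<in>bs.U. \<not> sieved M \<kappa> p m)} = S"
    by (simp add: S_def)
  ultimately have lower: "real N * ((1 - (\<Sum>j\<in>{1..K}. (1 / 4) ^ j)) * V {}) - (1 + real K) * bs.rem
    \<le> real (card S)"
    unfolding V by (simp only: card_atLeastAtMost diff_Suc_1 add_diff_cancel_right')
  have "(1 + real K) * bs.rem \<le> 2 ^ s * 2 ^ (68 * (s * X))"
  proof (intro mult_mono rem)
    have "1 + K \<le> 2 ^ s" using small_le_y s by (simp add: K_def y_def)
    then have "real (1 + K) \<le> real (2 ^ s)" by (simp only: of_nat_le_iff)
    then show "1 + real K \<le> 2 ^ s" by simp
  qed (use bs.rem_nonneg in auto)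
  also have "\<dots> \<le> 2 ^ (127 * (s * X)) / 6"
  proof -
    have "s + 3 + 68 * (s * X) \<le> 127 * (s * X)"
    proof -
      have "1 \<le> X" by (simp add: X_def)
      then have "s * 1 \<le> s * X" by (rule mult_le_mono2)
      then show ?thesis using s by linarith
    qed
    then have "(2::real) ^ (s + 3 + 68 * (s * X)) \<le> 2 ^ (127 * (s * X))" by (intro power_increasing) auto
    then have "8 * ((2::real) ^ s * 2 ^ (68 * (s * X))) \<le> 2 ^ (127 * (s * X))" by (simp add: power_add mult_ac)
    moreover have "(0::real) \<le> 2 ^ s * 2 ^ (68 * (s * X))" by simp
    ultimately show ?thesis by linarith
  qed
  also have "\<dots> \<le> real N * V {} / 6" using N_V_ge by simp
  finally have "(1 + real K) * bs.rem \<le> real N * V {} / 6" .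
  moreover have "real N * (2 / 3 * V {}) \<le> real N * ((1 - (\<Sum>j\<in>{1..K}. (1 / 4) ^ j)) * V {})"
    using sum_quarter V_pos[of "{}"] by (intro mult_left_mono mult_right_mono) auto
  ultimately show ?thesis using lower by simp
qed

lemma card_S_dvd_le:
  assumes D: "0 < D" "D \<le> 2 ^ (2 * (s * X))" "\<And>p. prime p \<Longrightarrow> p dvd D \<Longrightarrow> y < p"
  shows "real (card {m\<in>S. D dvd M * (m + 1) + k}) \<le> 4 * 2 ^ card (prime_factors D) * (real N * V {}) / real D"
proof -
  \<comment> \<open>An upper bound may ignore the sieve conditions at the primes dividing \<open>D\<close>; as \<open>\<kappa> p / p \<le> 1 / 2\<close>, this
    costs at most a factor \<open>2\<close> for each of them.\<close>
  define B where "B = prime_factors D"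
  have b2: "2 * (8 * j) = 16 * j" for j :: nat by simp
  interpret bs: block_sieve "{1..K}" "\<lambda>j. I j - B" \<kappa> "\<lambda>j. 8 * j" M by (rule block_sieve)
  have V: "bs.V = V B" unfolding bs.V_def V_def bs.g_def ..
  have rem: "bs.rem \<le> 2 ^ (68 * (s * X))" using rem_le[of B] unfolding bs.rem_def by (simp only: b2)
  have er: "bs.er bs.g j \<le> (1 / 4) ^ j * (\<Prod>p\<in>I j - B. 1 - bs.g p)" if "j \<in> {1..K}" for j
    using esym_g_le[OF that, of B] unfolding bs.er_def bs.g_def by simp
  have ndvd: "\<not> p dvd D" if "p \<in> bs.U" for p
    using that D(1) by (auto simp: B_def I_def in_prime_factors_iff)
  have cop: "coprime M D"
  proof (rule ccontr)
    assume "\<not> coprime M D"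
    then obtain c where c: "c dvd M" "c dvd D" "\<not> is_unit c" by (rule not_coprimeE)
    then obtain p where "prime p" "p dvd c" using prime_factor_nat[of c] by auto
    then have "prime p" "p dvd M" "p dvd D" using c dvd_trans by blast+
    then show False using not_dvd_M D(3) by blast
  qed
  have "{m\<in>S. D dvd M * (m + 1) + k} \<subseteq> {m. m < N \<and> D dvd M * (m + 1) + k \<and> (\<forall>p\<in>bs.U. \<not> sieved M \<kappa> p m)}"
    by (auto simp: S_def)
  then have "real (card {m\<in>S. D dvd M * (m + 1) + k}) \<le>
    real (card {m. m < N \<and> D dvd M * (m + 1) + k \<and> (\<forall>p\<in>bs.U. \<not> sieved M \<kappa> p m)})"
    unfolding of_nat_le_iff by (intro card_mono) auto
  also have "\<dots> \<le> real N / real D * (exp (\<Sum>j\<in>{1..K}. (1 / 4) ^ j) * V B) + bs.rem"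
    using bs.sieve_upper[OF ndvd cop D(1), of "\<lambda>j. (1 / 4) ^ j" N k] er by (simp only: V)
  \<comment> \<open>The final constant \<open>4\<close> is \<open>3\<close> from the exponential
    plus \<open>1\<close> from the remainder, which is absorbed because
    \<open>rem * D \<le> y ^ (70 * X)\<close> lies below \<open>N * V {}\<close>.\<close>
  also have "\<dots> \<le> real N / real D * (3 * (2 ^ card B * V {})) + 2 ^ card B * (real N * V {} / real D)"
  proof (intro add_mono mult_left_mono mult_mono V_remove)
    have "exp (\<Sum>j\<in>{1..K}. (1 / 4) ^ j) \<le> exp (1::real)" using sum_quarter by simp
    then show "exp (\<Sum>j\<in>{1..K}. (1 / 4) ^ j) \<le> (3::real)" using exp_le by linarith
    have "real D \<le> real (2 ^ (2 * (s * X)))" using D(2) by (simp only: of_nat_le_iff)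
    then have D': "real D \<le> 2 ^ (2 * (s * X))" by simp
    have "bs.rem * real D \<le> 2 ^ (68 * (s * X)) * 2 ^ (2 * (s * X))"
      by (intro mult_mono rem D') (auto)
    also have "\<dots> \<le> 2 ^ (127 * (s * X))" unfolding power_add[symmetric] by (intro power_increasing) auto
    also have "\<dots> \<le> 1 * (real N * V {})" using N_V_ge by simp
    also have "\<dots> \<le> 2 ^ card B * (real N * V {})"
      using V_pos[of "{}"] by (intro mult_right_mono) auto
    finally show "bs.rem \<le> 2 ^ card B * (real N * V {} / real D)"
      using D(1) by (simp add: field_simps)
  qed (use V_pos[of B] in \<open>auto simp: B_def\<close>)
  also have "\<dots> = 4 * 2 ^ card B * (real N * V {}) / real D" using D(1) by (simp add: field_simps)
  finally show ?thesis unfolding B_def .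
qed

section \<open>Exceptional survivors\<close>

text \<open>The primes in between: those up to \<open>z k\<close> are at most \<open>y\<close> or
  sieved out, and those above \<open>w k\<close> are few because \<open>n + k\<close> is at most a
  fixed power of \<open>y ^ X\<close>.\<close>

definition P :: "nat \<Rightarrow> nat set" where "P k = {p. prime p \<and> z k < p \<and> p \<le> w k}"

text \<open>The threshold \<open>1800 = 2 * 9 * 100\<close> pays for \<open>2 ^ k\<close> from the
  primes omitted from the sieve and \<open>9 ^ k\<close> from the reciprocal sum, leaving
  \<open>(1 / 100) ^ k\<close>.\<close>

definition many_primes :: "nat \<Rightarrow> nat set" where
  "many_primes k = {m\<in>S. 1800 * k \<le> card {p\<in>P k. p dvd M * (m + 1) + k}}"

text \<open>The conditions on \<open>d\<close> are those of \<open>Omega_on_le_square_part\<close>;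
  they also make \<open>d\<^sup>2\<close> a divisor to which \<open>card_S_dvd_le'\<close>
  applies.\<close>

definition large_square :: "nat \<Rightarrow> nat set" where
  "large_square k = {m\<in>S. \<exists>d. d\<^sup>2 dvd M * (m + 1) + k \<and> y ^ k < d \<and> d \<le> w k ^ k \<and>
    prime_factors d \<subseteq> P k \<and> card (prime_factors d) \<le> k}"

lemma finite_S: "finite S"
  unfolding S_def by auto

lemma finite_P: "finite (P k)"
  unfolding P_def by (rule finite_subset[of _ "{..w k}"]) auto

lemma P_gt_y: "p \<in> P k \<Longrightarrow> prime p \<and> y < p \<and> p \<le> w k"
  unfolding P_def using y_le_z[of k] by auto

lemma w_power_le: "w k ^ k \<le> 2 ^ (s * X)"
proof -
  have "s * (X div k) * k \<le> s * X" by (simp add: mult.assoc)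
  then have "(2::nat) ^ (s * (X div k) * k) \<le> 2 ^ (s * X)" by (rule power_increasing) simp
  then show ?thesis by (simp add: w_def power_mult)
qed

lemma sum_recip_P: "(\<Sum>p\<in>P k. 1 / real p) \<le> 2 * real k"
proof (cases "k = 0")
  case True
  \<comment> \<open>Division by zero gives \<open>X div 0 = 0\<close>, so \<open>w 0 = 1\<close> and
    the range is empty.\<close>
  have "P 0 = {}" using z_antimono[of 0 0] y_le_z[of 0] small_le_y by (auto simp: P_def w_def)
  then show ?thesis using True by simp
next
  case False
  have "w k ^ 1 \<le> w k ^ k" using False by (intro power_increasing) (auto simp: w_def)
  then have "w k \<le> 2 ^ (s * X)" using w_power_le[of k] by simp
  then have "recip_sum (z k) (w k) \<le> recip_sum (z k) (2 ^ (s * X))"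
    by (intro recip_sum_mono) auto
  also have "\<dots> \<le> 2 * real k" by (rule recip_sum_z)
  finally show ?thesis by (simp add: recip_sum_def P_def)
qed

lemma card_S_dvd_le':
  assumes "0 < D" "D \<le> 2 ^ (2 * (s * X))" "prime_factors D \<subseteq> P k" "card (prime_factors D) \<le> k"
  shows "real (card {m\<in>S. D dvd M * (m + 1) + l}) \<le> 4 * 2 ^ k * (real N * V {}) * (1 / real D)"
proof -
  have "y < p" if "prime p" "p dvd D" for p
    using that assms(1,3) P_gt_y[of p k] by (auto simp: in_prime_factors_iff subset_iff)
  then have "real (card {m\<in>S. D dvd M * (m + 1) + l}) \<le>
      4 * 2 ^ card (prime_factors D) * (real N * V {}) / real D"
    using assms by (intro card_S_dvd_le) auto
  also have "\<dots> \<le> 4 * 2 ^ k * (real N * V {}) / real D"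
    using assms(4) V_pos[of "{}"]
    by (intro divide_right_mono mult_right_mono mult_left_mono power_increasing) auto
  finally show ?thesis by simp
qed

text \<open>
  A factorial moment of order \<open>k\<close>: each \<open>m\<close> counted here has at least \<open>1800 ^ k\<close> divisors of \<open>n + k\<close>
  that are products of \<open>k\<close> primes of \<open>P k\<close>, and these divisors are at most \<open>w k ^ k\<close>, which is within
  reach of the sieve.
\<close>

lemma card_many_primes:
  assumes "0 < k"
  shows "real (card (many_primes k)) \<le> 4 * (real N * V {}) * (1 / 100) ^ k"
proof -
  let ?F = "{Y. Y \<subseteq> P k \<and> card Y = k}" and ?A = "\<lambda>Y. {m\<in>S. \<Prod>Y dvd M * (m + 1) + k}"
  have finF: "finite ?F" using finite_P by simp
  have finE: "finite (many_primes k)" using finite_S by (simp add: many_primes_def)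
  have many: "1800 ^ k \<le> real (card {Y\<in>?F. m \<in> ?A Y})" if m: "m \<in> many_primes k" for m
  proof -
    let ?Q = "{p\<in>P k. p dvd M * (m + 1) + k}"
    have finQ: "finite ?Q" using finite_P by simp
    have Q: "1800 * k \<le> card ?Q" and mS: "m \<in> S" using m by (auto simp: many_primes_def)
    have "(1800::real) \<le> real (card ?Q) / real k"
    proof -
      have "real (1800 * k) \<le> real (card ?Q)" using Q by (simp only: of_nat_le_iff)
      then show ?thesis using assms by (simp add: le_divide_eq)
    qed
    then have "1800 ^ k \<le> (real (card ?Q) / real k) ^ k" by (intro power_mono) auto
    also have "\<dots> \<le> real (card ?Q choose k)"
      using Q by (intro binomial_ge_n_over_k_pow_k) auto
    also have "\<dots> = real (card {Y. Y \<subseteq> ?Q \<and> card Y = k})"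
      using n_subsets[OF finQ] by simp
    also have "\<dots> \<le> real (card {Y\<in>?F. m \<in> ?A Y})"
      unfolding of_nat_le_iff
    proof (intro card_mono subsetI)
      show "finite {Y\<in>?F. m \<in> ?A Y}" by (rule finite_subset[OF _ finF]) auto
      fix Y assume Y: "Y \<in> {Y. Y \<subseteq> ?Q \<and> card Y = k}"
      have "\<Prod>Y dvd M * (m + 1) + k"
      proof (rule prod_coprime_dvd)
        show "finite Y" using Y finQ finite_subset by blast
        fix p assume "p \<in> Y"
        then show "p dvd M * (m + 1) + k" using Y by blast
        fix q assume "q \<in> Y" "p \<noteq> q"
        then show "coprime p q" using \<open>p \<in> Y\<close> Y P_gt_y by (intro primes_coprime) blast+
      qed
      then show "Y \<in> {Y\<in>?F. m \<in> ?A Y}" using Y mS by auto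
    qed
    finally show ?thesis .
  qed
  \<comment> \<open>Double counting of pairs of an \<open>m\<close> and a \<open>k\<close>-element
    set of primes whose product divides \<open>n + k\<close>.\<close>
  have "1800 ^ k * real (card (many_primes k)) = (\<Sum>m\<in>many_primes k. 1800 ^ k)" by simp
  also have "\<dots> \<le> (\<Sum>m\<in>many_primes k. real (card {Y\<in>?F. m \<in> ?A Y}))"
    using many by (rule sum_mono)
  also have "\<dots> = (\<Sum>m\<in>many_primes k. \<Sum>Y\<in>?F. of_bool (m \<in> ?A Y))"
    using finF by (intro sum.cong refl) (simp add: sum_of_bool_eq Int_def)
  also have "\<dots> = (\<Sum>Y\<in>?F. \<Sum>m\<in>many_primes k. of_bool (m \<in> ?A Y))" by (rule sum.swap)
  also have "\<dots> \<le> (\<Sum>Y\<in>?F. 4 * 2 ^ k * (real N * V {}) * (\<Prod>p\<in>Y. 1 / real p))"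
  proof (rule sum_mono)
    fix Y assume Y: "Y \<in> ?F"
    have finY: "finite Y" using Y finite_P finite_subset by blast
    have pY: "prime p" "p \<le> w k" if "p \<in> Y" for p using that Y P_gt_y by auto
    have "(\<Sum>m\<in>many_primes k. of_bool (m \<in> ?A Y)) = real (card (many_primes k \<inter> ?A Y))"
      using finE by (simp add: sum_of_bool_eq Int_def)
    also have "\<dots> \<le> real (card (?A Y))"
      unfolding of_nat_le_iff using finite_S by (intro card_mono) auto
    also have "\<dots> \<le> 4 * 2 ^ k * (real N * V {}) * (1 / real (\<Prod>Y))"
    proof (intro card_S_dvd_le')
      show "0 < \<Prod>Y" using pY by (intro prod_pos) (auto simp: prime_gt_0_nat)
      have "\<Prod>Y \<le> (\<Prod>p\<in>Y. w k)" using pY by (intro prod_mono) auto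
      also have "\<dots> = w k ^ k" using Y by simp
      also have "\<dots> \<le> 2 ^ (s * X)" by (rule w_power_le)
      also have "\<dots> \<le> 2 ^ (2 * (s * X))" by (intro power_increasing) auto
      finally show "\<Prod>Y \<le> 2 ^ (2 * (s * X))" .
      have "prime_factors (\<Prod>Y) \<subseteq> Y"
      proof
        fix q assume "q \<in> prime_factors (\<Prod>Y)"
        then have "prime q" "q dvd \<Prod>Y" by auto
        then obtain p where "p \<in> Y" "q dvd p" using finY by (auto simp: prime_dvd_prod_iff)
        then show "q \<in> Y" using \<open>prime q\<close> pY primes_dvd_imp_eq by blast
      qed
      then show "prime_factors (\<Prod>Y) \<subseteq> P k" "card (prime_factors (\<Prod>Y)) \<le> k"
        using Y card_mono[OF finY] by auto
    qed
    finally show "(\<Sum>m\<in>many_primes k. of_bool (m \<in> ?A Y)) \<le> 4 * 2 ^ k * (real N * V {}) * (\<Prod>p\<in>Y. 1 / real p)"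
      by (simp add: prod_dividef)
  qed
  also have "\<dots> = 4 * 2 ^ k * (real N * V {}) * esym k (\<lambda>p. 1 / real p) (P k)"
    by (simp add: esym_def sum_distrib_left)
  also have "\<dots> \<le> 4 * 2 ^ k * (real N * V {}) * 9 ^ k"
  proof (intro mult_left_mono)
    have "esym k (\<lambda>p. 1 / real p) (P k) \<le> (\<Sum>p\<in>P k. 1 / real p) ^ k / fact k"
      using finite_P by (intro esym_le_power) auto
    also have "\<dots> \<le> (2 * real k) ^ k / fact k"
      by (intro divide_right_mono power_mono sum_recip_P sum_nonneg) auto
    also have "\<dots> \<le> exp (2 * real k)" by (intro power_over_fact_le_exp) auto
    also have "\<dots> \<le> 9 ^ k" using exp_of_nat_le[of "2 * k"] by (simp add: power_mult)
    finally show "esym k (\<lambda>p. 1 / real p) (P k) \<le> 9 ^ k" .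
  qed (use V_pos[of "{}"] in auto)
  finally have "1800 ^ k * real (card (many_primes k)) \<le> 4 * (real N * V {}) * (2 ^ k * 9 ^ k)"
    by (simp add: mult_ac)
  also have "(2::real) ^ k * 9 ^ k = 18 ^ k" by (simp flip: power_mult_distrib)
  also have "(18::real) ^ k = 1800 ^ k * (1 / 100) ^ k" by (simp flip: power_mult_distrib)
  finally have "1800 ^ k * real (card (many_primes k)) \<le> 1800 ^ k * (4 * (real N * V {}) * (1 / 100) ^ k)"
    by (simp add: mult_ac)
  then show ?thesis by (rule mult_left_le_imp_le) simp
qed

text \<open>A union bound over \<open>d\<close>: the sieve costs \<open>2 ^ k\<close>, and the
  reciprocal squares beyond \<open>y ^ k\<close> sum to at most \<open>(1 / y) ^ k\<close>, where
  \<open>y > 200\<close>.\<close>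

lemma card_large_square:
  assumes "0 < k"
  shows "real (card (large_square k)) \<le> 4 * (real N * V {}) * (1 / 100) ^ k"
proof -
  let ?D = "{d\<in>{y ^ k<..w k ^ k}. prime_factors d \<subseteq> P k \<and> card (prime_factors d) \<le> k}"
  let ?A = "\<lambda>d. {m\<in>S. d\<^sup>2 dvd M * (m + 1) + k}"
  have "card (large_square k) \<le> card (\<Union>d\<in>?D. ?A d)"
    using finite_S by (intro card_mono) (auto simp: large_square_def)
  also have "\<dots> \<le> (\<Sum>d\<in>?D. card (?A d))" by (intro card_UN_le) auto
  finally have "real (card (large_square k)) \<le> real (\<Sum>d\<in>?D. card (?A d))"
    by (simp only: of_nat_le_iff)
  also have "\<dots> \<le> (\<Sum>d\<in>?D. 4 * 2 ^ k * (real N * V {}) * (1 / (real d)\<^sup>2))"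
    unfolding of_nat_sum
  proof (intro sum_mono)
    fix d assume d: "d \<in> ?D"
    have "d\<^sup>2 \<le> (2 ^ (s * X))\<^sup>2"
      using d w_power_le[of k] by (intro power_mono) auto
    then have "d\<^sup>2 \<le> 2 ^ (2 * (s * X))" by (simp add: mult.commute flip: power_mult)
    then have "real (card (?A d)) \<le> 4 * 2 ^ k * (real N * V {}) * (1 / real (d\<^sup>2))"
      using d by (intro card_S_dvd_le') (auto simp: prime_factors_power)
    then show "real (card (?A d)) \<le> 4 * 2 ^ k * (real N * V {}) * (1 / (real d)\<^sup>2)" by simp
  qed
  also have "\<dots> = 4 * 2 ^ k * (real N * V {}) * (\<Sum>d\<in>?D. 1 / (real d)\<^sup>2)"
    by (simp add: sum_distrib_left)
  also have "\<dots> \<le> 4 * 2 ^ k * (real N * V {}) * (1 / 200) ^ k"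
  proof (intro mult_left_mono)
    have "(\<Sum>d\<in>?D. 1 / (real d)\<^sup>2) \<le> (\<Sum>d\<in>{y ^ k<..w k ^ k}. 1 / (real d)\<^sup>2)"
      by (intro sum_mono2) auto
    also have "\<dots> \<le> 1 / real (y ^ k)" using small_le_y by (intro sum_inverse_squares) auto
    also have "\<dots> = (1 / real y) ^ k" by (simp add: power_one_over)
    also have "\<dots> \<le> (1 / 200) ^ k"
      using small_le_y by (intro power_mono divide_left_mono) auto
    finally show "(\<Sum>d\<in>?D. 1 / (real d)\<^sup>2) \<le> (1 / 200) ^ k" .
  qed (use V_pos[of "{}"] in auto)
  also have "\<dots> = 4 * (real N * V {}) * (2 ^ k * (1 / 200) ^ k)" by simp
  also have "(2::real) ^ k * (1 / 200) ^ k = (1 / 100) ^ k" by (simp flip: power_mult_distrib)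
  finally show ?thesis .
qed

text \<open>The exceptional sets have total size at most \<open>8 / 99\<close> of
  \<open>N * V {}\<close>, less than the half guaranteed by \<open>card_S_ge\<close>. Shifts beyond
  \<open>X\<close> are handled in \<open>Omega_bound\<close> without the sieve.\<close>

lemma exists_good: "\<exists>m\<in>S. \<forall>k\<in>{1..X}. m \<notin> many_primes k \<and> m \<notin> large_square k"
proof (rule ccontr)
  assume "\<not> ?thesis"
  then have "S \<subseteq> (\<Union>k\<in>{1..X}. many_primes k \<union> large_square k)" by blast
  moreover have "finite (\<Union>k\<in>{1..X}. many_primes k \<union> large_square k)"
    using finite_S by (auto simp: many_primes_def large_square_def)
  ultimately have "card S \<le> card (\<Union>k\<in>{1..X}. many_primes k \<union> large_square k)"
    by (rule card_mono[rotated])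
  also have "\<dots> \<le> (\<Sum>k\<in>{1..X}. card (many_primes k \<union> large_square k))"
    by (intro card_UN_le) auto
  also have "\<dots> \<le> (\<Sum>k\<in>{1..X}. card (many_primes k) + card (large_square k))"
    by (intro sum_mono card_Un_le)
  finally have "real (card S) \<le> (\<Sum>k\<in>{1..X}. real (card (many_primes k)) + real (card (large_square k)))"
    unfolding of_nat_add[symmetric] of_nat_sum[symmetric] of_nat_le_iff .
  also have "\<dots> \<le> (\<Sum>k\<in>{1..X}. 8 * (real N * V {}) * (1 / 100) ^ k)"
  proof (intro sum_mono)
    fix k assume "k \<in> {1..X}"
    then have "0 < k" by simp
    then show "real (card (many_primes k)) + real (card (large_square k)) \<le> 8 * (real N * V {}) * (1 / 100) ^ k"
      using card_many_primes[of k] card_large_square[of k] by linarith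
  qed
  also have "\<dots> = 8 * (real N * V {}) * (\<Sum>k = 1..X. (1 / 100) ^ k)"
    by (simp add: sum_distrib_left)
  also have "\<dots> \<le> 8 * (real N * V {}) * (1 / 99)"
    using sum_powers_le[of "1 / 100" X] V_pos[of "{}"] by (intro mult_left_mono) auto
  finally have "real (card S) \<le> 8 * (real N * V {}) * (1 / 99)" .
  moreover have "0 < real N * V {}" using V_pos[of "{}"] by (simp add: N_def)
  ultimately show False using card_S_ge by linarith
qed

section \<open>Prime factors of \<open>n + k\<close> for a good survivor\<close>

lemma M_le_N: "M \<le> N"
proof -
  have "M \<le> (y ^ y) ^ (3 * s + 9)"
    unfolding M_def using fact_le_power[of y, where ?'a = nat] by (intro power_mono) auto
  also have "\<dots> = 2 ^ (s * (y * (3 * s + 9)))" by (simp add: y_def mult_ac flip: power_mult)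
  also have "\<dots> \<le> N" unfolding N_def
  proof (intro power_increasing)
    \<comment> \<open>As \<open>X = 2 * y\<^sup>2\<close>, one factor \<open>y\<close> is available
      to absorb \<open>3 * s + 9\<close>.\<close>
    have "y * (3 * s + 9) \<le> y * (128 * y)" using small_le_y by (intro mult_left_mono) auto
    also have "\<dots> \<le> 128 * X"
      by (simp add: X_def K_def y_def mult_2 power_add)
    finally show "s * (y * (3 * s + 9)) \<le> 128 * (s * X)"
      using mult_le_mono2[of "y * (3 * s + 9)" "128 * X" s] by (simp add: mult_ac)
  qed auto
  finally show ?thesis .
qed

text \<open>For very large \<open>k\<close> the size of \<open>n + k\<close> suffices. Otherwise the
  primes up to \<open>y\<close> contribute at most \<open>k\<close>. Those above \<open>y\<close>
  number at most \<open>384 * X\<close> if \<open>k > X\<close>; if \<open>k \<le> X\<close>, they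
  split into the sieved range, \<open>P k\<close> and the primes above \<open>w k\<close>.\<close>

lemma Omega_bound:
  assumes m: "m \<in> S" "\<And>k. k \<in> {1..X} \<Longrightarrow> m \<notin> many_primes k \<and> m \<notin> large_square k" and k: "0 < k"
  shows "Omega (M * (m + 1) + k) \<le> 3000 * k"
proof (cases "256 * (s * X) \<le> k")
  have n_le: "M * (m + 1) \<le> 2 ^ (256 * (s * X))"
  proof -
    have "M * (m + 1) \<le> N * N" using m(1) by (intro mult_mono M_le_N) (auto simp: S_def)
    then show ?thesis by (simp add: N_def flip: power_add)
  qed
  {
    case True
    have "(2::nat) ^ (256 * (s * X)) \<le> 2 ^ k" using True by (intro power_increasing) auto
    then have "M * (m + 1) + k \<le> 2 ^ Suc k"
      using n_le less_exp[of k] unfolding power_Suc by linarith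
    then have "Omega (M * (m + 1) + k) \<le> Suc k" using k by (intro Omega_le_log) auto
    then show ?thesis using k by simp
  }
  let ?n = "M * (m + 1) + k"
  case False
  have "k \<le> 2 ^ (256 * (s * X))" using False less_exp[of "256 * (s * X)"] by linarith
  then have "?n \<le> 2 ^ Suc (256 * (s * X))" using n_le unfolding power_Suc by linarith
  also have "\<dots> \<le> 2 ^ (384 * (s * X))"
    using s by (intro power_increasing) (auto simp: X_def Suc_le_eq)
  finally have n_le': "?n \<le> 2 ^ (384 * (s * X))" .
  \<comment> \<open>Comparison of exponents of \<open>y\<close>, used with \<open>a = 1\<close> and
    \<open>a = X div k\<close>: the size of \<open>n + k\<close> leaves room for at most
    \<open>384 * X / a\<close> prime factors above \<open>y ^ a\<close>.\<close>
  have large: "a * Omega_on {p. 2 ^ (s * a) < p} ?n \<le> 384 * X" for a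
  proof -
    have "(2 ^ (s * a)) ^ Omega_on {p. 2 ^ (s * a) < p} ?n \<le> ?n"
      using k by (intro power_Omega_on_le) auto
    also note n_le'
    finally have "s * a * Omega_on {p. 2 ^ (s * a) < p} ?n \<le> 384 * (s * X)"
      unfolding power_mult[symmetric] by (rule power_le_imp_le_exp[rotated]) simp
    then have "s * (a * Omega_on {p. 2 ^ (s * a) < p} ?n) \<le> s * (384 * X)" by (simp add: mult_ac)
    then show ?thesis using s by simp
  qed
  have small: "Omega_on {p. p \<le> y} ?n \<le> k"
  proof (rule Omega_on_small_le[OF k])
    have "256 * (s * X) = 2 ^ (9 + 2 * s) * s" by (simp add: X_def K_def power_add)
    also have "\<dots> < 2 ^ (9 + 2 * s) * 2 ^ s" by (intro mult_strict_left_mono less_exp) auto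
    also have "\<dots> = 2 ^ (3 * s + 9)" by (simp add: add.commute flip: power_add)
    finally show "k < 2 ^ (3 * s + 9)" using False by linarith
    fix p :: nat assume p: "p \<in> {p. p \<le> y}" "prime p"
    have "p dvd fact y" using p by (simp add: prime_dvd_fact_iff)
    then have "p ^ (3 * s + 9) dvd M" unfolding M_def by (rule dvd_power_same)
    then show "p ^ (3 * s + 9) dvd M * (m + 1)" by (rule dvd_mult2)
  qed
  show ?thesis
  proof (cases "k \<le> X")
    case False
    have "UNIV = {p. p \<le> y} \<union> {p. 2 ^ (s * 1) < p}" by (auto simp: y_def)
    then have "Omega ?n \<le> k + Omega_on {p. 2 ^ (s * 1) < p} ?n"
      using Omega_on_Un[of "{p. p \<le> y}" "{p. 2 ^ (s * 1) < p}" ?n] small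
      by (simp add: Omega_on_UNIV[symmetric])
    then show ?thesis using large[of 1] False by simp
  next
    case True
    let ?q = "X div k"
    have kX: "k \<in> {1..X}" using True k by simp
    have q: "0 < ?q" using True k by (simp add: div_greater_zero_iff)
    \<comment> \<open>Rounding down costs at most a factor \<open>2\<close>, which turns
      \<open>384\<close> into \<open>768\<close>.\<close>
    have "X < Suc ?q * k" using k by (simp add: dividend_less_div_times)
    also have "\<dots> \<le> 2 * ?q * k" using q by (intro mult_right_mono) auto
    finally have "384 * X \<le> ?q * (768 * k)" by (simp add: mult_ac)
    then have "?q * Omega_on {p. w k < p} ?n \<le> ?q * (768 * k)"
      unfolding w_def by (rule order.trans[OF large])
    then have big: "Omega_on {p. w k < p} ?n \<le> 768 * k" using q by simp
    have "Omega_on (P k) ?n \<le> card {p\<in>P k. p dvd ?n} + 2 * k"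
    proof (rule Omega_on_le_square_part[of _ _ _ y "w k"])
      fix d assume "d\<^sup>2 dvd ?n" "y ^ k < d" "d \<le> w k ^ k" "prime_factors d \<subseteq> P k" "card (prime_factors d) \<le> k"
      then show False using m(1) m(2)[OF kX] by (auto simp: large_square_def)
    qed (use k P_gt_y in auto)
    moreover have "card {p\<in>P k. p dvd ?n} < 1800 * k"
      using m(1) m(2)[OF kX] by (simp add: many_primes_def not_le)
    ultimately have mid: "Omega_on (P k) ?n \<le> 1802 * k" by linarith
    have sieved: "Omega_on {p. y < p \<and> p \<le> z k} ?n = 0"
    proof -
      have False if p: "prime p" "p dvd ?n" "y < p" "p \<le> z k" for p
      proof -
        have "k \<le> K"
        proof (rule ccontr)
          assume "\<not> k \<le> K"
          then show False using p by (simp add: z_def y_def)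
        qed
        let ?J = "{j\<in>{1..K}. p \<le> z j}"
        have "k \<in> ?J" using k \<open>k \<le> K\<close> p by simp
        \<comment> \<open>The largest index with \<open>p \<le> z i\<close> names the block of
          \<open>p\<close>; since \<open>k \<le> i\<close>, the shift \<open>k\<close> is among the
          \<open>\<kappa> p = i\<close> forbidden ones.\<close>
        define i where "i = Max ?J"
        have "finite ?J" by simp
        have i: "i \<in> ?J" "k \<le> i"
          unfolding i_def using Max_in[OF \<open>finite ?J\<close>] Max_ge[OF \<open>finite ?J\<close> \<open>k \<in> ?J\<close>] \<open>k \<in> ?J\<close>
          by blast+
        have "z (Suc i) < p"
        proof (rule ccontr)
          assume *: "\<not> z (Suc i) < p"
          show False
          proof (cases "Suc i \<le> K")
            case True
            then have "Suc i \<in> ?J" using * by simp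
            then have "Suc i \<le> i" unfolding i_def by (intro Max_ge) auto
            then show False by simp
          next
            case False
            then have "z (Suc i) = y" by (simp add: z_def y_def)
            then show False using * p by simp
          qed
        qed
        then have "p \<in> I i" using i p by (simp add: I_def)
        moreover have "i \<in> {1..K}" using i by simp
        ultimately have "\<kappa> p = i" "\<not> sieved M \<kappa> p m"
          using kappa_I m(1) by (auto simp: S_def)
        then show False using i k p unfolding sieved_def by auto
      qed
      then have "prime_factors ?n \<inter> {p. y < p \<and> p \<le> z k} = {}"
        by (auto simp: in_prime_factors_iff)
      then show ?thesis by (simp add: Omega_on_def)
    qed
    let ?A = "{p. p \<le> y}" and ?B = "{p. y < p \<and> p \<le> z k}" and ?C = "{p. w k < p}"
    have "Omega ?n = Omega_on (?A \<union> ?B \<union> P k \<union> ?C) ?n"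
      unfolding Omega_def Omega_on_def by (intro sum.cong) (auto simp: P_def)
    also have "\<dots> \<le> Omega_on ?A ?n + Omega_on ?B ?n + Omega_on (P k) ?n + Omega_on ?C ?n"
      using Omega_on_Un[of "?A \<union> ?B \<union> P k" ?C ?n] Omega_on_Un[of "?A \<union> ?B" "P k" ?n]
        Omega_on_Un[of ?A ?B ?n] by linarith
    \<comment> \<open>The four ranges contribute \<open>1 + 0 + 1802 + 768 = 2571\<close> times
      \<open>k\<close>.\<close>
    also have "\<dots> \<le> 3000 * k" using small big mid sieved by linarith
    finally show ?thesis .
  qed
qed

section \<open>Passage to infinitely many \<open>n\<close>\<close>

lemma s_less_M: "s < M"
proof -
  have "s < y" unfolding y_def by (rule less_exp)
  also have "\<dots> \<le> fact y" by (rule fact_ge_self)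
  also have "\<dots> \<le> M" unfolding M_def by (intro self_le_power) auto
  finally show ?thesis .
qed

lemma exists_bounded_Omega: "\<exists>n>s. \<forall>k>0. Omega (n + k) \<le> 3000 * k"
proof -
  obtain m where "m \<in> S" "\<And>k. k \<in> {1..X} \<Longrightarrow> m \<notin> many_primes k \<and> m \<notin> large_square k"
    using exists_good by blast
  then have "\<forall>k>0. Omega (M * (m + 1) + k) \<le> 3000 * k" using Omega_bound by blast
  moreover have "s < M * (m + 1)" using s_less_M by simp
  ultimately show ?thesis by blast
qed

end

theorem theorem1p1:
  shows "\<exists>C::real. C > 0 \<and>
    infinite {n::nat. n > 0 \<and>
      (\<forall>k::nat. k > 0 \<longrightarrow>
         omega (n + k) \<le> Omega (n + k) \<and> real (Omega (n + k)) \<le> C * real k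
         \<and> real (tau (n + k)) \<le> 2 powr (C * real k))}"
proof (intro exI conjI)
  let ?A = "{n::nat. n > 0 \<and> (\<forall>k::nat. k > 0 \<longrightarrow>
    omega (n + k) \<le> Omega (n + k) \<and> real (Omega (n + k)) \<le> 3000 * real k
    \<and> real (tau (n + k)) \<le> 2 powr (3000 * real k))}"
  show "infinite ?A"
    unfolding infinite_nat_iff_unbounded
  proof
    fix b :: nat
    \<comment> \<open>The scale is at least \<open>b\<close>, which forces \<open>n > b\<close>, and
      at least \<open>8\<close>, as the locale demands.\<close>
    interpret scale "max b 8" by unfold_locales simp
    obtain n where n: "max b 8 < n" "\<And>k. 0 < k \<Longrightarrow> Omega (n + k) \<le> 3000 * k"
      using exists_bounded_Omega by blast
    have "real (Omega (n + k)) \<le> 3000 * real k \<and> real (tau (n + k)) \<le> 2 powr (3000 * real k)" if k: "0 < k" for k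
    proof
      have "real (Omega (n + k)) \<le> real (3000 * k)" using n(2)[OF k] by (simp only: of_nat_le_iff)
      then show *: "real (Omega (n + k)) \<le> 3000 * real k" by simp
      have "real (tau (n + k)) \<le> real (2 ^ Omega (n + k))"
        unfolding of_nat_le_iff using k by (intro tau_le) auto
      also have "\<dots> = 2 powr real (Omega (n + k))" by (simp add: powr_realpow)
      also have "\<dots> \<le> 2 powr (3000 * real k)" using * by (intro powr_mono) auto
      finally show "real (tau (n + k)) \<le> 2 powr (3000 * real k)" .
    qed
    then have "n \<in> ?A" using n(1) omega_le_Omega by auto
    then show "\<exists>n>b. n \<in> ?A" using n(1) by (intro exI[of _ n]) auto
  qed
qed simp

end
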